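(* Let $\lambda(t)>0$, $\mu(t)\ge0$, $\nu(t)\ge0$ be continuous functions on $[t_0;+\infty)$. Then for each $\phi_{(0)},\phi_{(1)}\in\mathbb{R}$ the solution $\phi_0(t)$ of the Van der Pol type equation $$(\lambda(t)\phi'(t))'+\mu(t)(\phi^2(t)-1)\phi'(t)+\nu(t)\phi(t)=0,\qquad t\ge t_0,$$ satisfying $\phi_0(t_0)=\phi_{(0)}$, $\phi_0'(t_0)=\phi_{(1)}$, exists on $[t_0;+\infty)$. Moreover, if in addition the following two conditions hold: (a) $\displaystyle\int_{t_0}^{+\infty}\frac{d\tau}{\lambda(\tau)}=+\infty$ and, for every $\varepsilon\ge1$, $\displaystyle\int_{t_0}^{+\infty}\frac{d\tau}{\lambda(\tau)}\int_{t_0}^\tau\exp\Bigl\{-\int_s^\tau\frac{\mu(\xi)(\varepsilon^2-1)}{\lambda(\xi)}\,d\xi\Bigr\}\nu(s)\,ds=+\infty$; (b) there exists $\varepsilon_0>0$ such that for every $0<\varepsilon\le\varepsilon_0$ the linear equation $$(\lambda(t)\phi'(t))'+\mu(t)(\varepsilon^2-1)\phi'(t)+\nu(t)\phi(t)=0,\qquad t\ge t_0,$$ is oscillatory, then $\phi_0(t)$ is oscillatory.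
   Context: Fix $t_0\in\mathbb{R}$. A solution is a continuously differentiable function $\phi$ such that $\lambda\phi'$ is continuously differentiable and the equation holds. A solution is called oscillatory if it exists on $[t_0;+\infty)$ and changes sign in every neighborhood of $+\infty$. A linear equation is called oscillatory if all its nontrivial solutions are oscillatory.
   Formalization: The oscillation claim is stated only for initial data not both zero, since for zero initial data the solution is identically zero and never changes sign. *)

theory Defs
  imports "HOL-Analysis.Analysis"
begin

text \<open>
  Solutions on an interval \<open>J\<close> of the equation
  \<open>(l(t) \<phi>')' + q(t, \<phi>(t)) \<phi>' + \<nu>(t) \<phi> = 0\<close>.  Here \<open>d\<phi>\<close> is \<open>\<phi>'\<close> and \<open>w\<close> is \<open>(l \<phi>')'\<close>;
  derivatives are taken within \<open>J\<close>, so they are one-sided at an endpoint belonging to \<open>J\<close>.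
\<close>

definition is_solution_on ::
  "real set \<Rightarrow> (real \<Rightarrow> real) \<Rightarrow> (real \<Rightarrow> real \<Rightarrow> real) \<Rightarrow> (real \<Rightarrow> real) \<Rightarrow> (real \<Rightarrow> real) \<Rightarrow> bool"
where
  "is_solution_on J l q \<nu> \<phi> \<longleftrightarrow>
     (\<exists>d\<phi> w. continuous_on J d\<phi> \<and> continuous_on J w \<and>
        (\<forall>t\<in>J. (\<phi> has_real_derivative d\<phi> t) (at t within J) \<and>
               ((\<lambda>s. l s * d\<phi> s) has_real_derivative w t) (at t within J) \<and>
               w t + q t (\<phi> t) * d\<phi> t + \<nu> t * \<phi> t = 0))"

definition solves_ivp_on ::
  "real set \<Rightarrow> (real \<Rightarrow> real) \<Rightarrow> (real \<Rightarrow> real \<Rightarrow> real) \<Rightarrow> (real \<Rightarrow> real) \<Rightarrow>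
   real \<Rightarrow> real \<Rightarrow> real \<Rightarrow> (real \<Rightarrow> real) \<Rightarrow> bool"
where
  "solves_ivp_on J l q \<nu> t0 a b \<phi> \<longleftrightarrow>
     is_solution_on J l q \<nu> \<phi> \<and> \<phi> t0 = a \<and> (\<phi> has_real_derivative b) (at t0 within J)"

definition oscillatory_solution ::
  "real \<Rightarrow> (real \<Rightarrow> real) \<Rightarrow> (real \<Rightarrow> real \<Rightarrow> real) \<Rightarrow> (real \<Rightarrow> real) \<Rightarrow> (real \<Rightarrow> real) \<Rightarrow> bool"
where
  "oscillatory_solution t0 l q \<nu> \<phi> \<longleftrightarrow>
     is_solution_on {t0..} l q \<nu> \<phi> \<and>
     (\<forall>T\<ge>t0. \<exists>s\<ge>T. \<exists>t\<ge>T. \<phi> s < 0 \<and> 0 < \<phi> t)"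

text \<open>
  Linear equation \<open>(l(t) \<phi>')' + p(t) \<phi>' + \<nu>(t) \<phi> = 0\<close>; nontrivial means not identically zero
  on \<open>[t0, \<infinity>)\<close>.
\<close>

definition oscillatory_linear_equation ::
  "real \<Rightarrow> (real \<Rightarrow> real) \<Rightarrow> (real \<Rightarrow> real) \<Rightarrow> (real \<Rightarrow> real) \<Rightarrow> bool"
where
  "oscillatory_linear_equation t0 l p \<nu> \<longleftrightarrow>
     (\<forall>\<phi>. is_solution_on {t0..} l (\<lambda>t x. p t) \<nu> \<phi> \<and> (\<exists>t\<ge>t0. \<phi> t \<noteq> 0) \<longrightarrow>
          oscillatory_solution t0 l (\<lambda>t x. p t) \<nu> \<phi>)"

definition vdp_damping :: "(real \<Rightarrow> real) \<Rightarrow> real \<Rightarrow> real \<Rightarrow> real" where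
  "vdp_damping \<mu> t x = \<mu> t * (x\<^sup>2 - 1)"

end

theory Submission
  imports Defs
begin

text \<open>
  With \<open>y = l \<phi>'\<close> the energy \<open>E = \<phi>\<^sup>2 + y\<^sup>2\<close> satisfies \<open>E' \<le> C(t) E\<close>, because the cubic part of the
  damping only dissipates it.  So the cubic term may be truncated beyond the a priori bound, and the
  truncated, globally Lipschitz system has a unique global solution.

  If \<open>\<phi> \<ge> 0\<close> eventually, then either \<open>y\<close> becomes and stays negative, and the two divergent
  integrals of condition (a) drive \<open>\<phi>\<close> to \<open>-\<infinity>\<close>; or \<open>y \<ge> 0\<close>, so \<open>\<phi>\<close> is eventually bounded below by
  some \<open>\<epsilon> > 0\<close> and is a positive supersolution of the linear equation with parameter \<open>\<epsilon>\<close>, which by a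
  Wronskian argument rules out that this equation is oscillatory.
\<close>

text \<open>The damping changes sign at \<open>\<phi> = 1\<close>, which is why condition (a) has
  two integrals. Where \<open>0 \<le> \<phi> \<le> 1\<close> the damping cannot slow a descent:
  \<open>y\<close> stays below a negative constant and the integral of \<open>1 / l\<close>
  suffices. Where \<open>\<phi> \<ge> 1\<close> it brakes, at most as strongly as with
  \<open>\<phi>\<close> replaced by its upper bound \<open>\<epsilon>\<close>; up to a constant
  factor, the velocity left after this braking is the inner integral of the second condition, hence
  its range \<open>\<epsilon> \<ge> 1\<close>. For a rising solution the replacement goes the other
  way: a lower bound \<open>\<epsilon>\<close> gives the weakest damping, and as this bound may be
  tiny, (b) ranges over all small \<open>\<epsilon>\<close>. Eventually nonpositive solutions are
  reflected, the damping being even in \<open>\<phi>\<close>.\<close>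

section \<open>Calculus on a half line: integrals, Gronwall, monotonicity\<close>

lemma integral_has_real_derivative_atLeast:
  fixes g :: "real \<Rightarrow> real"
  assumes "continuous_on {a..} g" "a \<le> t"
  shows "((\<lambda>x. integral {a..x} g) has_real_derivative g t) (at t within {a..})"
proof -
  \<comment> \<open>The fundamental theorem is available on compact intervals; the right end
    \<open>t+1\<close> keeps \<open>t\<close> away from the artificial endpoint, so that the filter
    agrees with that of the half line.\<close>
  have "((\<lambda>x. integral {a..x} g) has_real_derivative g t) (at t within {a..t+1})"
    using assms by (intro integral_has_real_derivative continuous_on_subset[OF assms(1)]) auto
  moreover have "at t within {a..t+1} = at t within {a..}"
    by (rule at_within_nhd[where S="{..<t+1}"]) auto
  ultimately show ?thesis by simp
qed

text \<open>The product of \<open>E\<close> with the integrating factor has nonpositive derivative.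
  No sign of \<open>E\<close> or \<open>C\<close> is assumed, which allows negative \<open>E\<close>
  (a negative velocity, or minus a squared distance for backward estimates) as well as
  \<open>C = 0\<close>.\<close>

lemma gronwall_interval:
  fixes E C :: "real \<Rightarrow> real"
  assumes C: "continuous_on {t0..} C" and J: "J \<subseteq> {t0..}" and st: "s \<le> t" "{s..t} \<subseteq> J"
    and E: "\<And>r. r \<in> {s..t} \<Longrightarrow> (E has_real_derivative E' r) (at r within J)"
    and le: "\<And>r. r \<in> {s..t} \<Longrightarrow> E' r \<le> C r * E r"
  shows "E t * exp (- integral {t0..t} C) \<le> E s * exp (- integral {t0..s} C)"
proof -
  define A where "A = (\<lambda>t. integral {t0..t} C)"
  have s0: "t0 \<le> s" using J st by auto
  have d: "((\<lambda>r. E r * exp (- A r)) has_real_derivative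
      (E' r - C r * E r) * exp (- A r)) (at r within {s..t})" if r: "r \<in> {s..t}" for r
  proof -
    have "(A has_real_derivative C r) (at r within {s..t})"
      unfolding A_def using r st J s0
      by (intro has_field_derivative_subset[OF integral_has_real_derivative_atLeast[OF C]]) auto
    moreover have "(E has_real_derivative E' r) (at r within {s..t})"
      using has_field_derivative_subset[OF E[OF r] st(2)] .
    ultimately show ?thesis
      by (auto intro!: derivative_eq_intros simp: algebra_simps)
  qed
  have "E t * exp (- A t) \<le> E s * exp (- A s)"
  proof (cases "s = t")
    case False
    with st have "s < t" by simp
    then obtain r where r: "r \<in> {s<..<t}"
      "E t * exp (- A t) - E s * exp (- A s) = (t - s) * ((E' r - C r * E r) * exp (- A r))"
      using mvt_simple[OF \<open>s < t\<close>, of "\<lambda>r. E r * exp (- A r)"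
          "\<lambda>r h. h * ((E' r - C r * E r) * exp (- A r))"] d
      by (auto simp: has_field_derivative_def mult_commute_abs)
    have "(E' r - C r * E r) * exp (- A r) \<le> 0"
      using le[of r] r(1) by (intro mult_nonpos_nonneg) auto
    then have "(t - s) * ((E' r - C r * E r) * exp (- A r)) \<le> 0"
      using \<open>s < t\<close> by (simp add: mult_nonneg_nonpos)
    then show ?thesis using r(2) by simp
  qed simp
  then show ?thesis unfolding A_def .
qed

lemma deriv_nonpos_imp_antimono:
  fixes f :: "real \<Rightarrow> real"
  assumes "s \<le> t" "{s..t} \<subseteq> J"
    and "\<And>r. r \<in> {s..t} \<Longrightarrow> (f has_real_derivative f' r) (at r within J)"
    and "\<And>r. r \<in> {s..t} \<Longrightarrow> f' r \<le> 0"
  shows "f t \<le> f s"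
proof -
  have "f t * exp (- integral {s..t} (\<lambda>_. 0)) \<le> f s * exp (- integral {s..s} (\<lambda>_. 0))"
    by (rule gronwall_interval[of s "\<lambda>_. 0" "{s..t}" s t f f'])
      (use assms in \<open>auto simp: has_field_derivative_subset[OF assms(3) assms(2)]\<close>)
  then show ?thesis by simp
qed

section \<open>Global existence and uniqueness for Lipschitz equations\<close>

text \<open>
  Writing \<open>x = exp K *\<^sub>R g\<close> with \<open>K' = 2 L\<close> turns the integral operator into a contraction with
  factor \<open>1/2\<close> on bounded continuous functions on the whole half line.
\<close>

lemma global_lipschitz_ode:
  fixes F :: "real \<Rightarrow> 'a::banach \<Rightarrow> 'a"
  assumes F_cont: "continuous_on ({t0..} \<times> UNIV) (\<lambda>(t, x). F t x)"
    and L_cont: "continuous_on {t0..} L"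
    and lip: "\<And>t x y. t \<ge> t0 \<Longrightarrow> norm (F t x - F t y) \<le> L t * norm (x - y)"
    and F_zero: "\<And>t. t \<ge> t0 \<Longrightarrow> F t 0 = 0" and L_nonneg: "\<And>t. t \<ge> t0 \<Longrightarrow> 0 \<le> L t"
  shows "\<exists>x. x t0 = x0 \<and> (\<forall>t\<ge>t0. (x has_vector_derivative F t (x t)) (at t within {t0..}))"
proof -
  define K where "K = (\<lambda>t. integral {t0..t} (\<lambda>s. 2 * L s))"
  have K_deriv: "(K has_real_derivative 2 * L t) (at t within {t0..})" if "t \<ge> t0" for t
    unfolding K_def using that by (intro integral_has_real_derivative_atLeast continuous_intros L_cont) auto
  have K_cont: "continuous_on {t0..} K"
    using K_deriv by (intro DERIV_continuous_on) simp
  have K0: "K t0 = 0" by (simp add: K_def)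
  have K_nonneg: "0 \<le> K t" if "t \<ge> t0" for t
    unfolding K_def using that L_nonneg L_cont
    by (intro integral_nonneg integrable_continuous_interval continuous_intros continuous_on_subset[OF L_cont]) auto
  have comp: "continuous_on {t0..} (\<lambda>s. F s (exp (K s) *\<^sub>R g s))" if "continuous_on {t0..} g" for g
  proof -
    have "continuous_on {t0..} (\<lambda>s. (s, exp (K s) *\<^sub>R g s))"
      using that K_cont by (intro continuous_intros)
    from continuous_on_compose2[OF F_cont this] show ?thesis by auto
  qed
  define I where "I = (\<lambda>g t. integral {t0..t} (\<lambda>s. F s (exp (K s) *\<^sub>R g s)))"
  \<comment> \<open>The weighted Lipschitz bound integrates exactly: \<open>exp K * L\<close> has
    antiderivative \<open>exp K / 2\<close>. This is the origin of the factor
    \<open>1/2\<close>.\<close>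
  have est: "exp (- K t) * norm (I g t - I h t) \<le> D / 2"
    if g: "continuous_on {t0..} g" and h: "continuous_on {t0..} h" and t: "t \<ge> t0"
      and D: "\<And>s. s \<ge> t0 \<Longrightarrow> norm (g s - h s) \<le> D" for g h t D
  proof -
    have gi: "(\<lambda>s. F s (exp (K s) *\<^sub>R g s)) integrable_on {t0..t}"
      and hi: "(\<lambda>s. F s (exp (K s) *\<^sub>R h s)) integrable_on {t0..t}"
      by (auto intro!: integrable_continuous_interval continuous_on_subset[OF comp[OF g]]
          continuous_on_subset[OF comp[OF h]])
    have D0: "0 \<le> D" using D[of t0] norm_ge_zero order_trans by blast
    have "((\<lambda>s. D * (exp (K s) * L s)) has_integral D * exp (K t) / 2 - D * exp (K t0) / 2) {t0..t}"
    proof (rule fundamental_theorem_of_calculus[OF t])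
      fix s assume s: "s \<in> {t0..t}"
      have "((\<lambda>s. D * exp (K s) / 2) has_real_derivative D * (exp (K s) * L s)) (at s within {t0..})"
        using K_deriv[of s] s by (auto intro!: derivative_eq_intros)
      then show "((\<lambda>s. D * exp (K s) / 2) has_vector_derivative D * (exp (K s) * L s)) (at s within {t0..t})"
        by (intro has_field_derivative_subset[THEN has_real_derivative_iff_has_vector_derivative[THEN iffD1]]) auto
    qed
    then have *: "((\<lambda>s. D * (exp (K s) * L s)) has_integral D * (exp (K t) - 1) / 2) {t0..t}"
      by (simp add: K0 algebra_simps diff_divide_distrib)
    have "norm (I g t - I h t) = norm (integral {t0..t} (\<lambda>s. F s (exp (K s) *\<^sub>R g s) - F s (exp (K s) *\<^sub>R h s)))"
      unfolding I_def by (simp add: integral_diff gi hi)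
    also have "\<dots> \<le> integral {t0..t} (\<lambda>s. D * (exp (K s) * L s))"
    proof (rule integral_norm_bound_integral)
      show "(\<lambda>s. D * (exp (K s) * L s)) integrable_on {t0..t}" using * by blast
      fix s assume s: "s \<in> {t0..t}"
      have "norm (F s (exp (K s) *\<^sub>R g s) - F s (exp (K s) *\<^sub>R h s))
          \<le> L s * norm (exp (K s) *\<^sub>R g s - exp (K s) *\<^sub>R h s)" using lip s by auto
      also have "\<dots> = L s * (exp (K s) * norm (g s - h s))"
        by (simp flip: scaleR_diff_right)
      also have "\<dots> \<le> L s * (exp (K s) * D)"
        using L_nonneg s D by (intro mult_left_mono) auto
      finally show "norm (F s (exp (K s) *\<^sub>R g s) - F s (exp (K s) *\<^sub>R h s)) \<le> D * (exp (K s) * L s)"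
        by (simp add: mult_ac)
    qed (intro integrable_diff gi hi)
    also have "\<dots> = D * (exp (K t) - 1) / 2" using * by (rule integral_unique)
    also have "\<dots> \<le> D * exp (K t) / 2" using D0 by (simp add: algebra_simps)
    finally show ?thesis by (simp add: exp_minus field_simps)
  qed
  have I_deriv: "(I g has_vector_derivative F t (exp (K t) *\<^sub>R g t)) (at t within {t0..})"
    if g: "continuous_on {t0..} g" and t: "t \<ge> t0" for g t
  proof -
    have "(I g has_vector_derivative F t (exp (K t) *\<^sub>R g t)) (at t within {t0..t+1})"
      unfolding I_def using t
      by (intro integral_has_vector_derivative continuous_on_subset[OF comp[OF g]]) auto
    moreover have "at t within {t0..t+1} = at t within {t0..}"
      by (rule at_within_nhd[where S="{..<t+1}"]) auto
    ultimately show ?thesis by simp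
  qed
  have I_cont: "continuous_on {t0..} (I g)" if "continuous_on {t0..} g" for g
    using I_deriv[OF that] by (intro continuous_on_vector_derivative) simp
  \<comment> \<open>Bounded continuous functions live on the whole line, so the operator is extended
    to \<open>t < t0\<close> by its value at \<open>t0\<close>.\<close>
  define p where "p = (\<lambda>g t. exp (- K (max t0 t)) *\<^sub>R (x0 + I g (max t0 t)))"
  have p_mem: "p (apply_bcontfun g) \<in> bcontfun" for g :: "real \<Rightarrow>\<^sub>C 'a"
  proof -
    have gc: "continuous_on {t0..} (apply_bcontfun g)" by simp
    have "continuous_on UNIV (p g)"
      unfolding p_def
      by (intro continuous_intros continuous_on_compose2[OF K_cont] continuous_on_compose2[OF I_cont[OF gc]]) auto
    moreover have "norm (p g t) \<le> norm x0 + norm g / 2" for t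
    proof -
      define r where "r = max t0 t"
      have r: "r \<ge> t0" by (simp add: r_def)
      \<comment> \<open>Since \<open>F\<close> vanishes at 0, the contraction estimate against the
        zero function bounds \<open>I g\<close> itself; this keeps the image of \<open>p\<close>
        among the bounded functions.\<close>
      have I0: "I (\<lambda>_. 0) r = 0"
        unfolding I_def by (subst integral_cong[where g="\<lambda>_. 0"]) (auto simp: F_zero)
      have "exp (- K r) * norm (I g r - I (\<lambda>_. 0) r) \<le> norm g / 2"
        by (rule est[OF gc _ r]) (auto simp: norm_bounded)
      moreover have "exp (- K r) * norm x0 \<le> norm x0"
        using K_nonneg[OF r] by (intro mult_left_le_one_le) auto
      moreover have "norm (p g t) \<le> exp (- K r) * (norm x0 + norm (I g r))"
        unfolding p_def r_def[symmetric] by (simp add: norm_triangle_ineq)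
      ultimately show ?thesis by (simp add: I0 algebra_simps)
    qed
    ultimately show ?thesis by (rule bcontfun_normI)
  qed
  define P where "P = (\<lambda>g :: real \<Rightarrow>\<^sub>C 'a. Bcontfun (p (apply_bcontfun g)))"
  have P_apply: "apply_bcontfun (P g) = p (apply_bcontfun g)" for g
    unfolding P_def using p_mem by (simp add: Bcontfun_inverse)
  have "\<exists>!g. P g = g"
  proof (rule banach_fix_type[of "1/2"])
    show "\<forall>g h. dist (P g) (P h) \<le> 1 / 2 * dist g h"
    proof (intro allI)
      fix g h
      show "dist (P g) (P h) \<le> 1 / 2 * dist g h"
      proof (rule dist_bound)
        fix t
        define r where "r = max t0 t"
        have r: "r \<ge> t0" by (simp add: r_def)
        have "exp (- K r) * norm (I g r - I h r) \<le> dist g h / 2"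
          by (rule est[OF _ _ r]) (simp_all add: dist_bounded flip: dist_norm)
        moreover have "dist (P g t) (P h t) = exp (- K r) * norm (I g r - I h r)"
          unfolding P_apply p_def r_def[symmetric] dist_norm by (simp flip: scaleR_diff_right)
        ultimately show "dist (P g t) (P h t) \<le> 1 / 2 * dist g h" by simp
      qed
    qed
  qed auto
  then obtain g where g: "P g = g" by blast
  have gc: "continuous_on {t0..} (apply_bcontfun g)" by simp
  define x where "x = (\<lambda>t. exp (K t) *\<^sub>R apply_bcontfun g t)"
  have x_eq: "x t = x0 + I g t" if "t \<ge> t0" for t
  proof -
    have "apply_bcontfun g t = p g t" using P_apply[of g] g by simp
    then show ?thesis using that by (simp add: x_def p_def max_def exp_minus)
  qed
  have "(x has_vector_derivative F t (x t)) (at t within {t0..})" if t: "t \<ge> t0" for t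
  proof -
    have "((\<lambda>t. x0 + I g t) has_vector_derivative F t (x t)) (at t within {t0..})"
      using I_deriv[OF gc t] by (auto simp: x_def intro!: derivative_eq_intros)
    then show ?thesis
      by (rule has_vector_derivative_transform[rotated 2]) (use t x_eq in auto)
  qed
  moreover have "x t0 = x0" using x_eq[of t0] by (simp add: I_def)
  ultimately show ?thesis by blast
qed

text \<open>The squared distance \<open>N\<close> satisfies
  \<open>\<bar>N'\<bar> \<le> 2 * L * N\<close>, and Gronwall propagates \<open>N = 0\<close> from
  \<open>s\<close> in both directions. An inner product makes the squared norm
  differentiable.\<close>

lemma lipschitz_ode_unique:
  fixes F :: "real \<Rightarrow> 'a::real_inner \<Rightarrow> 'a"
  assumes L_cont: "continuous_on {t0..} L" and J: "J \<subseteq> {t0..}" "is_interval J"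
    and lip: "\<And>t x y. t \<ge> t0 \<Longrightarrow> norm (F t x - F t y) \<le> L t * norm (x - y)"
    and X: "\<And>t. t \<in> J \<Longrightarrow> (X has_vector_derivative F t (X t)) (at t within J)"
    and Y: "\<And>t. t \<in> J \<Longrightarrow> (Y has_vector_derivative F t (Y t)) (at t within J)"
    and st: "s \<in> J" "t \<in> J" and eq: "X s = Y s"
  shows "X t = Y t"
proof -
  define N where "N = (\<lambda>t. inner (X t - Y t) (X t - Y t))"
  define N' where "N' = (\<lambda>t. 2 * inner (X t - Y t) (F t (X t) - F t (Y t)))"
  have N: "(N has_real_derivative N' r) (at r within J)" if "r \<in> J" for r
  proof -
    have "((\<lambda>t. X t - Y t) has_derivative (\<lambda>h. h *\<^sub>R (F r (X r) - F r (Y r)))) (at r within J)"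
      using has_vector_derivative_diff[OF X[OF that] Y[OF that]] by (simp add: has_vector_derivative_def)
    from has_derivative_inner[OF this this] show ?thesis
      unfolding N_def N'_def has_field_derivative_def
      by (rule has_derivative_eq_rhs) (simp add: fun_eq_iff inner_commute)
  qed
  have bound: "\<bar>N' r\<bar> \<le> 2 * L r * N r" if "r \<in> J" for r
  proof -
    have "\<bar>N' r\<bar> \<le> 2 * (norm (X r - Y r) * norm (F r (X r) - F r (Y r)))"
      unfolding N'_def using Cauchy_Schwarz_ineq2 by (simp add: abs_mult)
    also have "\<dots> \<le> 2 * (norm (X r - Y r) * (L r * norm (X r - Y r)))"
      using lip J that by (intro mult_left_mono) auto
    also have "\<dots> = 2 * L r * N r"
      unfolding N_def by (simp add: power2_eq_square flip: power2_norm_eq_inner)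
    finally show ?thesis .
  qed
  have sub: "{u..v} \<subseteq> J" if "u \<in> J" "v \<in> J" for u v
    using mem_is_interval_1_I[OF J(2) that] by auto
  have "N t \<le> 0"
  proof (cases "s \<le> t")
    case True
    have "N t * exp (- integral {t0..t} (\<lambda>r. 2 * L r)) \<le> N s * exp (- integral {t0..s} (\<lambda>r. 2 * L r))"
    proof (rule gronwall_interval[OF _ J(1) True sub[OF st]])
      fix r assume "r \<in> {s..t}"
      then have r: "r \<in> J" using sub[OF st] by auto
      show "(N has_real_derivative N' r) (at r within J)" using N[OF r] .
      show "N' r \<le> 2 * L r * N r" using bound[OF r] by linarith
    qed (intro continuous_intros L_cont)
    moreover have "N s = 0" by (simp add: N_def eq)
    ultimately show ?thesis by (simp add: mult_le_0_iff)
  next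
    case False
    \<comment> \<open>Backward in time the inequality \<open>- N' \<le> 2 * L * N\<close> is read as
      a Gronwall inequality for \<open>- N\<close> with rate \<open>- 2 * L\<close>.\<close>
    have "- N s * exp (- integral {t0..s} (\<lambda>r. - (2 * L r))) \<le> - N t * exp (- integral {t0..t} (\<lambda>r. - (2 * L r)))"
    proof (rule gronwall_interval[OF _ J(1) _ sub[OF st(2,1)]])
      fix r assume "r \<in> {t..s}"
      then have r: "r \<in> J" using sub[OF st(2,1)] by auto
      show "((\<lambda>r. - N r) has_real_derivative - N' r) (at r within J)"
        using N[OF r] by (auto intro!: derivative_eq_intros)
      show "- N' r \<le> - (2 * L r) * - N r" using bound[OF r] by linarith
    qed (use False in \<open>auto intro!: continuous_intros L_cont\<close>)
    moreover have "N s = 0" by (simp add: N_def eq)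
    ultimately show ?thesis by (simp add: mult_le_0_iff)
  qed
  then have "inner (X t - Y t) (X t - Y t) = 0"
    using inner_ge_zero[of "X t - Y t"] unfolding N_def by (rule order_antisym)
  then have "X t - Y t = 0" by (simp only: inner_eq_zero_iff)
  then show ?thesis by simp
qed

section \<open>Reduction to a first-order system\<close>

text \<open>The second unknown is \<open>l\<close> times the derivative of \<open>x\<close> rather
  than that derivative: \<open>l\<close> is merely continuous, so only the product need be
  differentiable.\<close>

definition solves_system ::
  "real set \<Rightarrow> (real \<Rightarrow> real) \<Rightarrow> (real \<Rightarrow> real \<Rightarrow> real) \<Rightarrow> (real \<Rightarrow> real) \<Rightarrow> (real \<Rightarrow> real) \<Rightarrow> (real \<Rightarrow> real) \<Rightarrow> bool"
where
  "solves_system J l q \<nu> x y \<longleftrightarrow>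
     (\<forall>t\<in>J. (x has_real_derivative y t / l t) (at t within J) \<and>
            (y has_real_derivative - (q t (x t) * (y t / l t)) - \<nu> t * x t) (at t within J))"

lemma solves_systemD:
  assumes "solves_system J l q \<nu> x y" "t \<in> J"
  shows "(x has_real_derivative y t / l t) (at t within J)"
    and "(y has_real_derivative - (q t (x t) * (y t / l t)) - \<nu> t * x t) (at t within J)"
  using assms by (auto simp: solves_system_def)

lemma solves_system_continuous_on:
  assumes "solves_system J l q \<nu> x y"
  shows "continuous_on J x" "continuous_on J y"
  by (rule DERIV_continuous_on, erule solves_systemD[OF assms])+

lemma solves_system_subset:
  assumes "solves_system J l q \<nu> x y" "I \<subseteq> J"
  shows "solves_system I l q \<nu> x y"
  unfolding solves_system_def
proof (intro ballI conjI)
  fix t assume t: "t \<in> I"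
  then have "t \<in> J" using assms(2) by blast
  note d = solves_systemD[OF assms(1) this]
  show "(x has_real_derivative y t / l t) (at t within I)"
    by (rule has_field_derivative_subset[OF d(1) assms(2)])
  show "(y has_real_derivative - (q t (x t) * (y t / l t)) - \<nu> t * x t) (at t within I)"
    by (rule has_field_derivative_subset[OF d(2) assms(2)])
qed

lemma solves_system_imp_is_solution_on:
  assumes sys: "solves_system J l q \<nu> x y"
    and l: "\<And>t. t \<in> J \<Longrightarrow> l t \<noteq> 0" "continuous_on J l"
    and q: "continuous_on J (\<lambda>t. q t (x t))" and nu: "continuous_on J \<nu>"
  shows "is_solution_on J l q \<nu> x"
proof -
  define w where "w = (\<lambda>t. - (q t (x t) * (y t / l t)) - \<nu> t * x t)"
  note c = solves_system_continuous_on[OF sys]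
  have "continuous_on J (\<lambda>t. y t / l t)" using l c by (intro continuous_intros) auto
  moreover have "continuous_on J w" unfolding w_def using l c q nu by (intro continuous_intros) auto
  moreover have "((\<lambda>s. l s * (y s / l s)) has_real_derivative w t) (at t within J)" if "t \<in> J" for t
    using solves_systemD(2)[OF sys that] unfolding has_field_derivative_def w_def
    by (rule has_derivative_transform[rotated 2]) (use that l in auto)
  ultimately show ?thesis
    unfolding is_solution_on_def using solves_systemD(1)[OF sys]
    by (intro exI[of _ "\<lambda>t. y t / l t"] exI[of _ w]) (auto simp: w_def)
qed

lemma is_solution_on_imp_solves_system:
  assumes sol: "is_solution_on J l q \<nu> x" and l: "\<And>t. t \<in> J \<Longrightarrow> l t \<noteq> 0"
  shows "\<exists>y. solves_system J l q \<nu> x y"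
proof -
  obtain dx w where *: "\<forall>t\<in>J. (x has_real_derivative dx t) (at t within J) \<and>
      ((\<lambda>s. l s * dx s) has_real_derivative w t) (at t within J) \<and>
      w t + q t (x t) * dx t + \<nu> t * x t = 0"
    using sol unfolding is_solution_on_def by blast
  have "w t = - (q t (x t) * dx t) - \<nu> t * x t" if "t \<in> J" for t
  proof -
    have "w t + q t (x t) * dx t + \<nu> t * x t = 0" using * that by blast
    then show ?thesis by linarith
  qed
  then show ?thesis
    unfolding solves_system_def using l *
    by (intro exI[of _ "\<lambda>t. l t * dx t"]) auto
qed

section \<open>Truncation of the cubic term\<close>

definition clamp_abs :: "real \<Rightarrow> real \<Rightarrow> real" where
  "clamp_abs r x = max (- r) (min r x)"

lemma clamp_abs_eq: "\<bar>x\<bar> \<le> r \<Longrightarrow> clamp_abs r x = x"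
  by (auto simp: clamp_abs_def)

lemma abs_clamp_abs_le: "0 \<le> r \<Longrightarrow> \<bar>clamp_abs r x\<bar> \<le> r"
  by (auto simp: clamp_abs_def)

lemma clamp_abs_lipschitz: "\<bar>clamp_abs r x - clamp_abs r y\<bar> \<le> \<bar>x - y\<bar>"
  by (auto simp: clamp_abs_def min_def max_def)

lemma clamp_abs_mult_self_nonneg: "0 \<le> r \<Longrightarrow> 0 \<le> clamp_abs r x * x"
  by (auto simp: clamp_abs_def min_def max_def zero_le_mult_iff)

text \<open>Both factors are clamped because the rate of change of \<open>x\<^sup>2 * y\<close> in
  \<open>x\<close> still contains \<open>y\<close>. Changing one variable at a time gives
  \<open>X\<^sup>2 * (Y - Y') + Y' * (X + X') * (X - X')\<close>, where every coefficient is bounded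
  in terms of \<open>r\<close>.\<close>

lemma clamp_abs_cubic_lipschitz:
  assumes r: "0 \<le> r"
  shows "\<bar>(clamp_abs r x)\<^sup>2 * clamp_abs r y - (clamp_abs r x')\<^sup>2 * clamp_abs r y'\<bar>
           \<le> r\<^sup>2 * \<bar>y - y'\<bar> + 2 * r\<^sup>2 * \<bar>x - x'\<bar>"
proof -
  define X X' Y Y' where "X = clamp_abs r x" "X' = clamp_abs r x'" "Y = clamp_abs r y" "Y' = clamp_abs r y'"
  note defs = this
  have b: "\<bar>X\<bar> \<le> r" "\<bar>X'\<bar> \<le> r" "\<bar>Y'\<bar> \<le> r"
    unfolding defs using r by (auto intro: abs_clamp_abs_le)
  have "X\<^sup>2 * Y - X'\<^sup>2 * Y' = X\<^sup>2 * (Y - Y') + Y' * (X + X') * (X - X')"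
    by (simp add: power2_eq_square algebra_simps)
  then have "\<bar>X\<^sup>2 * Y - X'\<^sup>2 * Y'\<bar> \<le> \<bar>X\<bar>\<^sup>2 * \<bar>Y - Y'\<bar> + \<bar>Y'\<bar> * \<bar>X + X'\<bar> * \<bar>X - X'\<bar>"
    using abs_triangle_ineq[of "X\<^sup>2 * (Y - Y')" "Y' * (X + X') * (X - X')"] by (simp add: abs_mult)
  also have "\<dots> \<le> r\<^sup>2 * \<bar>Y - Y'\<bar> + r * (2 * r) * \<bar>X - X'\<bar>"
    using b r by (intro add_mono mult_right_mono mult_mono power_mono) auto
  also have "\<dots> \<le> r\<^sup>2 * \<bar>y - y'\<bar> + r * (2 * r) * \<bar>x - x'\<bar>"
    unfolding defs using r by (intro add_mono mult_left_mono clamp_abs_lipschitz) auto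
  finally show ?thesis unfolding defs by (simp add: power2_eq_square)
qed

lemma filterlim_at_top_not_bounded:
  fixes f :: "real \<Rightarrow> real"
  assumes "filterlim f at_top at_top" "k > 0" "\<And>t. t \<ge> T \<Longrightarrow> k * f t \<le> C"
  shows False
proof -
  have "eventually (\<lambda>t. f t \<ge> C / k + 1) at_top"
    using assms(1) unfolding filterlim_at_top by blast
  then have "eventually (\<lambda>t. f t \<ge> C / k + 1 \<and> t \<ge> T) at_top"
    using eventually_ge_at_top by (rule eventually_conj)
  then obtain t where t: "f t \<ge> C / k + 1" "t \<ge> T"
    unfolding eventually_at_top_linorder by blast
  have "k * (C / k + 1) \<le> k * f t" using t(1) assms(2) by (intro mult_left_mono) auto
  then have "C + k \<le> k * f t" using assms(2) by (simp add: algebra_simps)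
  then show False using assms(2) assms(3)[OF t(2)] by simp
qed

section \<open>Energy estimate and a priori bound\<close>

locale vdp_coefficients =
  fixes t0 :: real and l \<mu> \<nu> :: "real \<Rightarrow> real"
  assumes l_cont: "continuous_on {t0..} l" and l_pos: "\<And>t. t \<ge> t0 \<Longrightarrow> l t > 0"
    and mu_cont: "continuous_on {t0..} \<mu>" and mu_nonneg: "\<And>t. t \<ge> t0 \<Longrightarrow> \<mu> t \<ge> 0"
    and nu_cont: "continuous_on {t0..} \<nu>" and nu_nonneg: "\<And>t. t \<ge> t0 \<Longrightarrow> \<nu> t \<ge> 0"
begin

lemma l_nonzero: "t \<ge> t0 \<Longrightarrow> l t \<noteq> 0"
  using l_pos[of t] by simp

text \<open>Each summand pays for one term of the derivative of
  \<open>x\<^sup>2 + y\<^sup>2\<close>: the linear part of the damping contributes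
  \<open>2 * (\<mu> / l) * y\<^sup>2\<close>, while \<open>2 * x * y / l\<close> and
  \<open>- 2 * \<nu> * x * y\<close> are bounded through
  \<open>\<bar>2 * x * y\<bar> \<le> x\<^sup>2 + y\<^sup>2\<close>.\<close>

definition energy_rate :: "real \<Rightarrow> real" where
  "energy_rate t = 2 * (\<mu> t / l t) + \<nu> t + 1 / l t"

lemma energy_rate_cont: "continuous_on {t0..} energy_rate"
  unfolding energy_rate_def using l_nonzero
  by (intro continuous_intros l_cont mu_cont nu_cont) auto

text \<open>Here \<open>h\<close> is the cubic term \<open>x\<^sup>2 y\<close> or its truncation.\<close>

lemma energy_bound:
  assumes J: "J \<subseteq> {t0..}" "is_interval J" "t0 \<in> J" and t: "t \<in> J"
    and x: "\<And>r. r \<in> J \<Longrightarrow> (x has_real_derivative y r / l r) (at r within J)"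
    and y: "\<And>r. r \<in> J \<Longrightarrow> (y has_real_derivative - (\<mu> r / l r * (h r - y r)) - \<nu> r * x r) (at r within J)"
    and h: "\<And>r. r \<in> J \<Longrightarrow> 0 \<le> h r * y r"
  shows "(x t)\<^sup>2 + (y t)\<^sup>2 \<le> ((x t0)\<^sup>2 + (y t0)\<^sup>2) * exp (integral {t0..t} energy_rate)"
proof -
  have sub: "{t0..t} \<subseteq> J"
    using mem_is_interval_1_I[OF J(2,3) t] by auto
  have t0t: "t0 \<le> t" using J t by auto
  have "((x t)\<^sup>2 + (y t)\<^sup>2) * exp (- integral {t0..t} energy_rate)
      \<le> ((x t0)\<^sup>2 + (y t0)\<^sup>2) * exp (- integral {t0..t0} energy_rate)"
  proof (rule gronwall_interval[OF energy_rate_cont J(1) t0t sub])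
    fix r assume "r \<in> {t0..t}"
    then have r: "r \<in> J" "r \<ge> t0" using sub by auto
    let ?E' = "2 * x r * (y r / l r) + 2 * y r * (- (\<mu> r / l r * (h r - y r)) - \<nu> r * x r)"
    show "((\<lambda>r. (x r)\<^sup>2 + (y r)\<^sup>2) has_real_derivative ?E') (at r within J)"
      using x[OF r(1)] y[OF r(1)] by (auto intro!: derivative_eq_intros)
    have "?E' = (1 / l r) * (2 * x r * y r) + \<nu> r * (- (2 * x r * y r))
        + 2 * (\<mu> r / l r) * (y r)\<^sup>2 - 2 * (\<mu> r / l r) * (h r * y r)"
      by (simp add: algebra_simps power2_eq_square diff_divide_distrib)
    also have "\<dots> \<le> (1 / l r) * ((x r)\<^sup>2 + (y r)\<^sup>2) + \<nu> r * ((x r)\<^sup>2 + (y r)\<^sup>2)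
        + 2 * (\<mu> r / l r) * ((x r)\<^sup>2 + (y r)\<^sup>2) - 0"
      using l_pos[OF r(2)] mu_nonneg[OF r(2)] nu_nonneg[OF r(2)] h[OF r(1)]
        sum_squares_bound[of "x r" "y r"] sum_squares_bound[of "- x r" "y r"]
      by (intro add_mono diff_mono mult_left_mono mult_nonneg_nonneg[of _ "h r * y r"]) auto
    also have "\<dots> = energy_rate r * ((x r)\<^sup>2 + (y r)\<^sup>2)"
      by (simp add: energy_rate_def algebra_simps)
    finally show "?E' \<le> energy_rate r * ((x r)\<^sup>2 + (y r)\<^sup>2)" .
  qed
  then show ?thesis by (simp add: exp_minus field_simps)
qed

text \<open>With \<open>E\<close> the energy at \<open>t0\<close>, this is the a priori bound for
  both \<open>\<bar>x\<bar>\<close> and \<open>\<bar>y\<bar>\<close>; as a truncation level it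
  depends on time and on the initial data.\<close>

definition radius :: "real \<Rightarrow> real \<Rightarrow> real" where
  "radius E t = sqrt (E * exp (integral {t0..t} energy_rate))"

lemma radius_nonneg: "0 \<le> E \<Longrightarrow> 0 \<le> radius E t"
  by (simp add: radius_def)

lemma radius_cont: "continuous_on {t0..} (radius E)"
proof -
  have "continuous_on {t0..} (\<lambda>t. integral {t0..t} energy_rate)"
    using integral_has_real_derivative_atLeast[OF energy_rate_cont]
    by (intro DERIV_continuous_on) simp
  then show ?thesis unfolding radius_def by (intro continuous_intros)
qed

section \<open>Truncated and original equation: existence and uniqueness\<close>

text \<open>Only the cubic term is clamped. Its product with \<open>y\<close> stays nonnegative, so
  the energy estimate survives the truncation.\<close>

definition truncated_vdp :: "real \<Rightarrow> real \<Rightarrow> real \<times> real \<Rightarrow> real \<times> real" where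
  "truncated_vdp E t z =
     (snd z / l t,
      - (\<mu> t / l t * ((clamp_abs (radius E t) (fst z))\<^sup>2 * clamp_abs (radius E t) (snd z) - snd z))
        - \<nu> t * fst z)"

text \<open>The 3 collects the constants 1 and 2 of the Lipschitz bound for the clamped cubic term,
  both differences being at most the norm of the pair.\<close>

definition truncated_lipschitz :: "real \<Rightarrow> real \<Rightarrow> real" where
  "truncated_lipschitz E t = 1 / l t + \<mu> t / l t * (3 * (radius E t)\<^sup>2 + 1) + \<nu> t"

lemma truncated_lipschitz_cont: "continuous_on {t0..} (truncated_lipschitz E)"
  unfolding truncated_lipschitz_def using l_nonzero
  by (intro continuous_intros l_cont mu_cont nu_cont radius_cont) auto

lemma truncated_lipschitz_nonneg: "t \<ge> t0 \<Longrightarrow> 0 \<le> truncated_lipschitz E t"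
  unfolding truncated_lipschitz_def using l_pos[of t] mu_nonneg[of t] nu_nonneg[of t] by auto

lemma truncated_vdp_cont: "continuous_on ({t0..} \<times> UNIV) (\<lambda>(t, z). truncated_vdp E t z)"
proof -
  have c: "continuous_on ({t0..} \<times> UNIV) (\<lambda>z :: real \<times> real \<times> real. f (fst z))"
    if "continuous_on {t0..} f" for f :: "real \<Rightarrow> real"
    by (intro continuous_on_compose2[OF that] continuous_intros) auto
  show ?thesis
    unfolding truncated_vdp_def clamp_abs_def case_prod_unfold
    by (intro continuous_intros c l_cont mu_cont nu_cont radius_cont) (auto dest: l_nonzero)
qed

lemma truncated_vdp_zero: "0 \<le> E \<Longrightarrow> truncated_vdp E t 0 = 0"
  by (simp add: truncated_vdp_def clamp_abs_def radius_nonneg zero_prod_def)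

lemma truncated_vdp_lipschitz:
  assumes E: "0 \<le> E" and t: "t \<ge> t0"
  shows "norm (truncated_vdp E t z - truncated_vdp E t z') \<le> truncated_lipschitz E t * norm (z - z')"
proof -
  define R where "R = radius E t"
  define d where "d = norm (z - z')"
  define H where "H = (\<lambda>z. (clamp_abs R (fst z))\<^sup>2 * clamp_abs R (snd z))"
  have x: "\<bar>fst z - fst z'\<bar> \<le> d" and y: "\<bar>snd z - snd z'\<bar> \<le> d"
    unfolding d_def using norm_fst_le[of "fst z - fst z'" "snd z - snd z'"]
      norm_snd_le[of "snd z - snd z'" "fst z - fst z'"] by (auto simp: minus_prod_def)
  have R: "0 \<le> R" unfolding R_def using E by (rule radius_nonneg)
  have H: "\<bar>H z - H z'\<bar> \<le> R\<^sup>2 * d + 2 * R\<^sup>2 * d"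
    unfolding H_def
    by (rule order_trans[OF clamp_abs_cubic_lipschitz[OF R]]) (intro add_mono mult_left_mono x y, auto)
  have m: "0 \<le> \<mu> t / l t" "0 \<le> \<nu> t" "0 \<le> 1 / l t"
    using l_pos[OF t] mu_nonneg[OF t] nu_nonneg[OF t] by auto
  have "truncated_vdp E t z - truncated_vdp E t z' = (1 / l t * (snd z - snd z'),
      - (\<mu> t / l t * ((H z - H z') - (snd z - snd z'))) - \<nu> t * (fst z - fst z'))" (is "_ = (?u, ?v)")
    by (simp add: truncated_vdp_def H_def R_def algebra_simps diff_divide_distrib)
  then have "norm (truncated_vdp E t z - truncated_vdp E t z') \<le> \<bar>?u\<bar> + \<bar>?v\<bar>"
    using norm_Pair_le[of ?u ?v] by simp
  also have "\<dots> \<le> 1 / l t * d + (\<mu> t / l t * ((R\<^sup>2 * d + 2 * R\<^sup>2 * d) + d) + \<nu> t * d)"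
  proof (rule add_mono)
    show "\<bar>?u\<bar> \<le> 1 / l t * d"
      using mult_left_mono[OF y m(3)] m(3) by (simp add: abs_mult)
    have "\<bar>?v\<bar> \<le> \<mu> t / l t * \<bar>(H z - H z') - (snd z - snd z')\<bar> + \<nu> t * \<bar>fst z - fst z'\<bar>"
      using abs_triangle_ineq4[of "- (\<mu> t / l t * ((H z - H z') - (snd z - snd z')))" "\<nu> t * (fst z - fst z')"] m
      by (simp only: abs_mult abs_minus_cancel abs_of_nonneg)
    also have "\<dots> \<le> \<mu> t / l t * ((R\<^sup>2 * d + 2 * R\<^sup>2 * d) + d) + \<nu> t * d"
      using H x y m by (intro add_mono mult_left_mono) auto
    finally show "\<bar>?v\<bar> \<le> \<dots>" .
  qed
  also have "\<dots> = truncated_lipschitz E t * d"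
    by (simp add: truncated_lipschitz_def R_def algebra_simps)
  finally show ?thesis unfolding d_def .
qed

text \<open>The energy estimate keeps both components within the radius, so the clamps are inactive.
  This transfers Lipschitz uniqueness to an equation that is only locally Lipschitz;
  \<open>t0 \<in> J\<close> because the truncation level is read off there.\<close>

lemma vdp_system_imp_truncated:
  assumes J: "J \<subseteq> {t0..}" "is_interval J" "t0 \<in> J"
    and sys: "solves_system J l (vdp_damping \<mu>) \<nu> x y" and t: "t \<in> J"
  shows "((\<lambda>t. (x t, y t)) has_vector_derivative truncated_vdp ((x t0)\<^sup>2 + (y t0)\<^sup>2) t (x t, y t)) (at t within J)"
proof -
  define R where "R = radius ((x t0)\<^sup>2 + (y t0)\<^sup>2) t"
  have "(x t)\<^sup>2 + (y t)\<^sup>2 \<le> ((x t0)\<^sup>2 + (y t0)\<^sup>2) * exp (integral {t0..t} energy_rate)"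
  proof (rule energy_bound[OF J t])
    fix r assume r: "r \<in> J"
    show "(x has_real_derivative y r / l r) (at r within J)" using solves_systemD(1)[OF sys r] .
    show "(y has_real_derivative - (\<mu> r / l r * ((x r)\<^sup>2 * y r - y r)) - \<nu> r * x r) (at r within J)"
      using solves_systemD(2)[OF sys r] by (simp add: vdp_damping_def algebra_simps)
    show "0 \<le> (x r)\<^sup>2 * y r * y r" by (simp add: mult.assoc)
  qed
  then have le: "sqrt ((x t)\<^sup>2 + (y t)\<^sup>2) \<le> R"
    unfolding R_def radius_def by (rule real_sqrt_le_mono)
  have "\<bar>x t\<bar> \<le> R" "\<bar>y t\<bar> \<le> R"
    using order_trans[OF real_sqrt_ge_abs1 le] order_trans[OF real_sqrt_ge_abs2 le] by auto
  then have "truncated_vdp ((x t0)\<^sup>2 + (y t0)\<^sup>2) t (x t, y t)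
      = (y t / l t, - (vdp_damping \<mu> t (x t) * (y t / l t)) - \<nu> t * x t)"
    by (simp add: truncated_vdp_def vdp_damping_def clamp_abs_eq flip: R_def) (simp add: algebra_simps)
  then show ?thesis
    using has_vector_derivative_Pair[OF solves_systemD[OF sys t, unfolded has_real_derivative_iff_has_vector_derivative]]
    by simp
qed

text \<open>Equal initial data give equal initial energy, hence one common truncated equation for
  the two solutions.\<close>

lemma vdp_system_unique:
  assumes J: "J \<subseteq> {t0..}" "is_interval J" "t0 \<in> J"
    and sys: "solves_system J l (vdp_damping \<mu>) \<nu> x y" and sys': "solves_system J l (vdp_damping \<mu>) \<nu> x' y'"
    and eq: "x t0 = x' t0" "y t0 = y' t0" and t: "t \<in> J"
  shows "x t = x' t"
proof -
  have "(\<lambda>t. (x t, y t)) t = (\<lambda>t. (x' t, y' t)) t"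
  proof (rule lipschitz_ode_unique[OF truncated_lipschitz_cont J(1,2) truncated_vdp_lipschitz _ _ J(3) t])
    show "0 \<le> (x t0)\<^sup>2 + (y t0)\<^sup>2" by simp
    fix s assume s: "s \<in> J"
    show "((\<lambda>t. (x t, y t)) has_vector_derivative truncated_vdp ((x t0)\<^sup>2 + (y t0)\<^sup>2) s (x s, y s)) (at s within J)"
      by (rule vdp_system_imp_truncated[OF J sys s])
    show "((\<lambda>t. (x' t, y' t)) has_vector_derivative truncated_vdp ((x t0)\<^sup>2 + (y t0)\<^sup>2) s (x' s, y' s)) (at s within J)"
      unfolding eq by (rule vdp_system_imp_truncated[OF J sys' s])
  qed (simp_all add: eq)
  then show ?thesis by simp
qed

text \<open>The zero function also solves the equation truncated at the level belonging to
  \<open>x\<close>. Uniqueness, run backward from \<open>t\<close> to \<open>t0\<close>, would force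
  zero initial data.\<close>

lemma vdp_system_nonzero:
  assumes sys: "solves_system {t0..} l (vdp_damping \<mu>) \<nu> x y"
    and nz: "(x t0, y t0) \<noteq> (0, 0)" and t: "t \<ge> t0"
  shows "(x t, y t) \<noteq> (0, 0)"
proof
  assume z: "(x t, y t) = (0, 0)"
  have J: "{t0..} \<subseteq> {t0..}" "is_interval {t0..}" "t0 \<in> {t0..}" by (auto simp: is_interval_1)
  have "(\<lambda>t. (x t, y t)) t0 = (\<lambda>_. 0) t0"
  proof (rule lipschitz_ode_unique[OF truncated_lipschitz_cont J(1,2) truncated_vdp_lipschitz _ _ _ J(3)])
    show "0 \<le> (x t0)\<^sup>2 + (y t0)\<^sup>2" by simp
    show "t \<in> {t0..}" using t by simp
    show "((\<lambda>t. (x t, y t)) has_vector_derivative truncated_vdp ((x t0)\<^sup>2 + (y t0)\<^sup>2) s (x s, y s)) (at s within {t0..})"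
      if "s \<in> {t0..}" for s
      by (rule vdp_system_imp_truncated[OF J sys that])
    show "((\<lambda>_. 0) has_vector_derivative truncated_vdp ((x t0)\<^sup>2 + (y t0)\<^sup>2) s 0) (at s within {t0..})" for s
      by (simp add: truncated_vdp_zero)
    show "(\<lambda>t. (x t, y t)) t = (\<lambda>_. 0) t" using z by (simp add: zero_prod_def)
  qed simp
  then show False using nz by (simp add: zero_prod_def)
qed

lemma vdp_system_exists:
  "\<exists>x y. solves_system {t0..} l (vdp_damping \<mu>) \<nu> x y \<and> x t0 = a \<and> y t0 = c"
proof -
  define E where "E = a\<^sup>2 + c\<^sup>2"
  have E: "0 \<le> E" by (simp add: E_def)
  obtain z where z0: "z t0 = (a, c)"
    and z: "\<And>t. t \<ge> t0 \<Longrightarrow> (z has_vector_derivative truncated_vdp E t (z t)) (at t within {t0..})"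
    using global_lipschitz_ode[OF truncated_vdp_cont truncated_lipschitz_cont truncated_vdp_lipschitz[OF E]
      truncated_vdp_zero[OF E] truncated_lipschitz_nonneg] by blast
  define x y where "x = (\<lambda>t. fst (z t))" and "y = (\<lambda>t. snd (z t))"
  define h where "h = (\<lambda>t. (clamp_abs (radius E t) (x t))\<^sup>2 * clamp_abs (radius E t) (y t))"
  have init: "x t0 = a" "y t0 = c" by (simp_all add: x_def y_def z0)
  have x: "(x has_real_derivative y t / l t) (at t within {t0..})"
    and y: "(y has_real_derivative - (\<mu> t / l t * (h t - y t)) - \<nu> t * x t) (at t within {t0..})"
    if "t \<ge> t0" for t
    using bounded_linear.has_vector_derivative[OF bounded_linear_fst z[OF that]]
      bounded_linear.has_vector_derivative[OF bounded_linear_snd z[OF that]]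
    by (simp_all add: x_def y_def h_def truncated_vdp_def has_real_derivative_iff_has_vector_derivative)
  have "solves_system {t0..} l (vdp_damping \<mu>) \<nu> x y"
    unfolding solves_system_def
  proof (intro ballI conjI)
    fix t assume t: "t \<in> {t0..}"
    define R where "R = radius E t"
    have "(x t)\<^sup>2 + (y t)\<^sup>2 \<le> ((x t0)\<^sup>2 + (y t0)\<^sup>2) * exp (integral {t0..t} energy_rate)"
    proof (rule energy_bound[of "{t0..}"])
      fix r assume "r \<in> {t0..}"
      \<comment> \<open>A clamped value has the sign of its argument, so truncation preserves
        dissipation. The resulting bound shows that the clamps never act along this
        solution.\<close>
      show "0 \<le> h r * y r"
        unfolding h_def using clamp_abs_mult_self_nonneg[OF radius_nonneg[OF E]] by (simp add: mult.assoc)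
    qed (use t x y in \<open>auto simp: is_interval_1\<close>)
    then have le: "sqrt ((x t)\<^sup>2 + (y t)\<^sup>2) \<le> R"
      unfolding R_def radius_def init E_def by (rule real_sqrt_le_mono)
    have "\<bar>x t\<bar> \<le> R" "\<bar>y t\<bar> \<le> R"
      using order_trans[OF real_sqrt_ge_abs1 le] order_trans[OF real_sqrt_ge_abs2 le] by auto
    then have "- (\<mu> t / l t * (h t - y t)) - \<nu> t * x t
        = - (vdp_damping \<mu> t (x t) * (y t / l t)) - \<nu> t * x t"
      unfolding h_def by (simp add: vdp_damping_def clamp_abs_eq flip: R_def) (simp add: algebra_simps)
    then show "(y has_real_derivative - (vdp_damping \<mu> t (x t) * (y t / l t)) - \<nu> t * x t) (at t within {t0..})"
      using y[of t] t by (simp only: atLeast_iff)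
    show "(x has_real_derivative y t / l t) (at t within {t0..})" using x t by simp
  qed
  then show ?thesis using init by blast
qed

section \<open>Linear equations and Wronskian comparison\<close>

text \<open>Oscillation of a linear equation speaks about all its nontrivial solutions; it can be
  exploited only once such a solution is at hand.\<close>

lemma linear_system_exists:
  assumes p: "continuous_on {t0..} p"
  shows "\<exists>x y. solves_system {t0..} l (\<lambda>t _. p t) \<nu> x y \<and> x t0 = a \<and> y t0 = c"
proof -
  define F where "F = (\<lambda>t (z :: real \<times> real). (snd z / l t, - (p t * (snd z / l t)) - \<nu> t * fst z))"
  define L where "L = (\<lambda>t. 1 / l t + \<bar>p t\<bar> / l t + \<nu> t)"
  have "\<exists>z. z t0 = (a, c) \<and> (\<forall>t\<ge>t0. (z has_vector_derivative F t (z t)) (at t within {t0..}))"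
  proof (rule global_lipschitz_ode)
    have c: "continuous_on ({t0..} \<times> UNIV) (\<lambda>z :: real \<times> real \<times> real. f (fst z))"
      if "continuous_on {t0..} f" for f :: "real \<Rightarrow> real"
      by (intro continuous_on_compose2[OF that] continuous_intros) auto
    show "continuous_on ({t0..} \<times> UNIV) (\<lambda>(t, z). F t z)"
      unfolding F_def case_prod_unfold
      by (intro continuous_intros c l_cont nu_cont p) (auto dest: l_nonzero)
    show "continuous_on {t0..} L"
      unfolding L_def using l_nonzero by (intro continuous_intros l_cont nu_cont p) auto
    fix t assume t: "t \<ge> t0"
    have m: "0 \<le> \<nu> t" "0 < l t" using l_pos[OF t] nu_nonneg[OF t] by auto
    show "F t 0 = 0" by (simp add: F_def zero_prod_def)
    show "0 \<le> L t" using m by (simp add: L_def)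
    fix z z' :: "real \<times> real"
    define d where "d = norm (z - z')"
    have x: "\<bar>fst z - fst z'\<bar> \<le> d" and y: "\<bar>snd z - snd z'\<bar> \<le> d"
      unfolding d_def using norm_fst_le[of "fst z - fst z'" "snd z - snd z'"]
        norm_snd_le[of "snd z - snd z'" "fst z - fst z'"] by (auto simp: minus_prod_def)
    have "F t z - F t z' = ((snd z - snd z') / l t,
        - (p t * ((snd z - snd z') / l t)) - \<nu> t * (fst z - fst z'))" (is "_ = (?u, ?v)")
      by (simp add: F_def algebra_simps diff_divide_distrib)
    then have "norm (F t z - F t z') \<le> \<bar>?u\<bar> + \<bar>?v\<bar>"
      using norm_Pair_le[of ?u ?v] by simp
    also have "\<dots> \<le> \<bar>snd z - snd z'\<bar> / l t + (\<bar>p t\<bar> * (\<bar>snd z - snd z'\<bar> / l t) + \<nu> t * \<bar>fst z - fst z'\<bar>)"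
      using abs_triangle_ineq4[of "- (p t * ((snd z - snd z') / l t))" "\<nu> t * (fst z - fst z')"] m
      by (simp add: abs_mult)
    also have "\<dots> \<le> d / l t + (\<bar>p t\<bar> * (d / l t) + \<nu> t * d)"
      using m x y by (intro add_mono mult_left_mono divide_right_mono) auto
    also have "\<dots> = L t * d" by (simp add: L_def algebra_simps)
    finally show "norm (F t z - F t z') \<le> L t * norm (z - z')" unfolding d_def .
  qed
  then obtain z where z0: "z t0 = (a, c)"
    and z: "\<And>t. t \<ge> t0 \<Longrightarrow> (z has_vector_derivative F t (z t)) (at t within {t0..})" by blast
  have "solves_system {t0..} l (\<lambda>t _. p t) \<nu> (\<lambda>t. fst (z t)) (\<lambda>t. snd (z t))"
    unfolding solves_system_def
    using bounded_linear.has_vector_derivative[OF bounded_linear_fst z]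
      bounded_linear.has_vector_derivative[OF bounded_linear_snd z]
    by (auto simp: F_def has_real_derivative_iff_has_vector_derivative)
  then show ?thesis using z0 by (intro exI conjI) (assumption, simp_all)
qed

text \<open>A Sturm-type argument. An oscillating linear solution \<open>u\<close> has a positive
  hump beyond \<open>T\<close>, so \<open>u / x\<close> must rise and then fall on it. The sign of
  its slope is that of the Wronskian, which is nondecreasing there because \<open>x\<close> is
  damped at least as strongly as \<open>u\<close>.\<close>

lemma oscillatory_linear_comparison:
  assumes sys: "solves_system {t0..} l (vdp_damping \<mu>) \<nu> x y"
    and T: "T \<ge> t0" and \<epsilon>: "\<epsilon> > 0"
    and x_ge: "\<And>t. t \<ge> T \<Longrightarrow> \<epsilon> \<le> x t" and y_ge: "\<And>t. t \<ge> T \<Longrightarrow> 0 \<le> y t"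
  shows "\<not> oscillatory_linear_equation t0 l (\<lambda>t. \<mu> t * (\<epsilon>\<^sup>2 - 1)) \<nu>"
proof
  assume osc: "oscillatory_linear_equation t0 l (\<lambda>t. \<mu> t * (\<epsilon>\<^sup>2 - 1)) \<nu>"
  define p where "p = (\<lambda>t. \<mu> t * (\<epsilon>\<^sup>2 - 1))"
  have p: "continuous_on {t0..} p" unfolding p_def by (intro continuous_intros mu_cont)
  obtain u w where lin: "solves_system {t0..} l (\<lambda>t _. p t) \<nu> u w" and u0: "u t0 = 1"
    using linear_system_exists[OF p] by blast
  have u_cont: "continuous_on {t0..} u" using solves_system_continuous_on(1)[OF lin] .
  have "is_solution_on {t0..} l (\<lambda>t _. p t) \<nu> u"
    using l_nonzero by (intro solves_system_imp_is_solution_on[OF lin] l_cont p nu_cont) auto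
  then have "oscillatory_solution t0 l (\<lambda>t _. p t) \<nu> u"
    using osc u0 unfolding oscillatory_linear_equation_def p_def[symmetric] by fastforce
  then have sign: "\<exists>s\<ge>S. \<exists>t\<ge>S. u s < 0 \<and> 0 < u t" if "S \<ge> t0" for S
    using that unfolding oscillatory_solution_def by blast
  obtain c where c: "c \<ge> T" "u c < 0" using sign[OF T] by blast
  obtain m where m: "m \<ge> c" "0 < u m" using sign[of c] c T by auto
  obtain d where d: "d \<ge> m" "u d < 0" using sign[of m] m c T by auto
  have compact: "compact {r \<in> {a..b}. u r \<le> 0}" if "a \<ge> t0" for a b
  proof -
    have "closed {r \<in> {a..b}. u r \<le> 0}"
      using that by (intro continuous_on_closed_Collect_le continuous_on_subset[OF u_cont] continuous_intros) auto
    then have "compact ({a..b} \<inter> {r \<in> {a..b}. u r \<le> 0})" by (intro compact_Int_closed) auto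
    moreover have "{a..b} \<inter> {r \<in> {a..b}. u r \<le> 0} = {r \<in> {a..b}. u r \<le> 0}" by auto
    ultimately show ?thesis by simp
  qed
  \<comment> \<open>The hump around \<open>m\<close> is delimited by the last point before
    \<open>m\<close> and the first point after \<open>m\<close> where \<open>u \<le> 0\<close>;
    compactness provides both.\<close>
  obtain s where s: "s \<in> {c..m}" "u s \<le> 0" and s_max: "\<And>r. r \<in> {c..m} \<Longrightarrow> u r \<le> 0 \<Longrightarrow> r \<le> s"
    using compact_attains_sup[OF compact[of c m]] c m T by fastforce
  obtain q where q: "q \<in> {m..d}" "u q \<le> 0" and q_min: "\<And>r. r \<in> {m..d} \<Longrightarrow> u r \<le> 0 \<Longrightarrow> q \<le> r"
    using compact_attains_inf[OF compact[of m d]] d m c T by fastforce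
  have sm: "s < m" and mq: "m < q" using s q m by (auto simp: order_le_less)
  have u_pos: "0 < u r" if "s < r" "r < q" for r
    using s_max[of r] q_min[of r] that s q by (cases "r \<le> m") (force simp: not_le[symmetric])+
  define A where "A = (\<lambda>t. integral {t0..t} (\<lambda>t. p t / l t))"
  have A: "(A has_real_derivative p t / l t) (at t within {t0..})" if "t \<ge> t0" for t
    unfolding A_def using l_nonzero that
    by (intro integral_has_real_derivative_atLeast continuous_intros p l_cont) auto
  \<comment> \<open>The factor \<open>exp (A t)\<close> removes the damping \<open>p\<close> common
    to both equations, and the \<open>\<nu>\<close> terms cancel. What remains of the derivative is
    \<open>\<mu> / l * (x\<^sup>2 - \<epsilon>\<^sup>2) * y * u * exp A\<close>, nonnegative on the
    hump.\<close>
  define W where "W = (\<lambda>t. (w t * x t - y t * u t) * exp (A t))"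
  have W_mono: "W r \<le> W r'" if r: "s < r" "r \<le> r'" "r' < q" for r r'
  proof -
    have "- W r' \<le> - W r"
    proof (rule deriv_nonpos_imp_antimono[of r r' "{t0..}" "\<lambda>t. - W t"])
      show "r \<le> r'" using r by simp
      show "{r..r'} \<subseteq> {t0..}" using r s c T by auto
      fix t assume "t \<in> {r..r'}"
      then have t: "s < t" "t < q" "t0 \<le> t" "T \<le> t" using r s c T by auto
      have t': "t \<in> {t0..}" using t by simp
      have "l t \<noteq> 0" using l_nonzero t by simp
      then show "((\<lambda>t. - W t) has_real_derivative - (\<mu> t / l t * ((x t)\<^sup>2 - \<epsilon>\<^sup>2) * y t * u t * exp (A t)))
          (at t within {t0..})"
        unfolding W_def
        using solves_systemD[OF sys t'] solves_systemD[OF lin t'] A[OF t(3)]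
        by (auto intro!: derivative_eq_intros simp: p_def vdp_damping_def field_simps power2_eq_square)
      have "\<epsilon>\<^sup>2 \<le> (x t)\<^sup>2" using x_ge[OF t(4)] \<epsilon> by (intro power_mono) auto
      then have "0 \<le> \<mu> t / l t * ((x t)\<^sup>2 - \<epsilon>\<^sup>2) * y t * u t * exp (A t)"
        using y_ge[OF t(4)] u_pos[OF t(1,2)] mu_nonneg[OF t(3)] l_pos[OF t(3)]
        by (intro mult_nonneg_nonneg) auto
      then show "- (\<mu> t / l t * ((x t)\<^sup>2 - \<epsilon>\<^sup>2) * y t * u t * exp (A t)) \<le> 0" by simp
    qed
    then show ?thesis by simp
  qed
  \<comment> \<open>The quotient rule gives a derivative equal to \<open>W\<close> times a positive
    weight. Mean values on both sides of \<open>m\<close> then yield \<open>W > 0\<close> followed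
    later by \<open>W < 0\<close>.\<close>
  define v where "v = (\<lambda>t. u t / x t)"
  define v' where "v' = (\<lambda>t. W t * (exp (- A t) / (l t * (x t)\<^sup>2)))"
  have x_pos: "0 < x t" if "t \<ge> T" for t using x_ge[OF that] \<epsilon> by simp
  have v: "(v has_real_derivative v' t) (at t within {a..b})" if "T \<le> a" "t \<in> {a..b}" for t a b
  proof -
    have t: "t \<ge> T" "t \<in> {t0..}" using that T by auto
    have "(v has_real_derivative v' t) (at t within {t0..})"
      unfolding v_def v'_def W_def
      using solves_systemD(1)[OF sys t(2)] solves_systemD(1)[OF lin t(2)] x_pos[OF t(1)] l_nonzero t(2)
      by (auto intro!: derivative_eq_intros simp: exp_minus field_simps power2_eq_square)
    then show ?thesis by (rule has_field_derivative_subset) (use that T in auto)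
  qed
  have mvt: "\<exists>r\<in>{a<..<b}. v b - v a = v' r * (b - a)" if "T \<le> a" "a < b" for a b
    using mvt_simple[OF that(2), of v "\<lambda>r h. v' r * h"] v[OF that(1)]
    by (auto simp: has_field_derivative_def)
  have weight: "0 < exp (- A t) / (l t * (x t)\<^sup>2)" if "T \<le> t" for t
    using x_pos[OF that] l_pos[of t] that T by simp
  have Tm: "T \<le> s" "T \<le> m" "T \<le> q" using c s m q by auto
  have vs: "v s \<le> 0" "0 < v m" "v q \<le> 0"
    unfolding v_def using x_pos[OF Tm(1)] x_pos[OF Tm(2)] x_pos[OF Tm(3)] s q m
    by (auto simp: divide_le_0_iff)
  obtain r where r: "r \<in> {s<..<m}" "v m - v s = v' r * (m - s)" using mvt[OF Tm(1) sm] by blast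
  obtain r' where r': "r' \<in> {m<..<q}" "v q - v m = v' r' * (q - m)" using mvt[OF Tm(2) mq] by blast
  have "0 < v' r * (m - s)" using r(2) vs by simp
  then have "0 < v' r" using sm by (simp add: zero_less_mult_iff)
  then have "0 < W r"
    unfolding v'_def by (rule zero_less_mult_pos2) (use r(1) Tm in \<open>auto intro!: weight\<close>)
  moreover have "v' r' * (q - m) < 0" using r'(2) vs by simp
  then have "v' r' < 0" using mq by (simp add: mult_less_0_iff)
  then have "0 < - W r' * (exp (- A r') / (l r' * (x r')\<^sup>2))" unfolding v'_def by linarith
  then have "0 < - W r'"
    by (rule zero_less_mult_pos2) (use r'(1) Tm in \<open>auto intro!: weight\<close>)
  moreover have "W r \<le> W r'" using r r' by (intro W_mono) auto
  ultimately show False by simp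
qed

section \<open>Nonnegative solutions with negative velocity\<close>

text \<open>The restoring force only lowers \<open>y\<close>; dropping it leaves a homogeneous
  linear inequality, and its integrating factor is positive.\<close>

lemma velocity_stays_negative:
  assumes sys: "solves_system {t0..} l (vdp_damping \<mu>) \<nu> x y"
    and t1: "t1 \<ge> t0" and x_nonneg: "\<And>t. t \<ge> t1 \<Longrightarrow> 0 \<le> x t" and neg: "y t1 < 0" and t: "t \<ge> t1"
  shows "y t < 0"
proof -
  define C where "C = (\<lambda>t. - (vdp_damping \<mu> t (x t) / l t))"
  have "y t * exp (- integral {t0..t} C) \<le> y t1 * exp (- integral {t0..t1} C)"
  proof (rule gronwall_interval[of t0 C "{t0..}"])
    show "continuous_on {t0..} C"
      unfolding C_def vdp_damping_def using l_nonzero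
      by (intro continuous_intros mu_cont l_cont solves_system_continuous_on(1)[OF sys]) auto
    fix r assume r: "r \<in> {t1..t}"
    then have r0: "r \<in> {t0..}" using t1 by auto
    show "(y has_real_derivative - (vdp_damping \<mu> r (x r) * (y r / l r)) - \<nu> r * x r) (at r within {t0..})"
      by (rule solves_systemD(2)[OF sys r0])
    have "0 \<le> \<nu> r * x r" using r r0 x_nonneg nu_nonneg by auto
    then show "- (vdp_damping \<mu> r (x r) * (y r / l r)) - \<nu> r * x r \<le> C r * y r"
      by (simp add: C_def)
  qed (use t t1 in auto)
  also have "\<dots> < 0" using neg by (simp add: mult_less_0_iff)
  finally show ?thesis by (simp add: mult_less_0_iff)
qed

text \<open>Below 1 the damping is nonpositive, so with \<open>y < 0\<close> both terms push
  \<open>y\<close> further down. Thus \<open>y \<le> - k\<close>, and integrating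
  \<open>- k / l\<close> makes \<open>x\<close> unbounded below.\<close>

lemma slow_decreasing_contradiction:
  assumes sys: "solves_system {t0..} l (vdp_damping \<mu>) \<nu> x y"
    and t1: "t1 \<ge> t0" and x: "\<And>t. t \<ge> t1 \<Longrightarrow> 0 \<le> x t" "\<And>t. t \<ge> t1 \<Longrightarrow> x t \<le> 1"
    and y: "\<And>t. t \<ge> t1 \<Longrightarrow> y t < 0"
    and div: "filterlim (\<lambda>T. integral {t0..T} (\<lambda>\<tau>. 1 / l \<tau>)) at_top at_top"
  shows False
proof -
  define k where "k = - y t1"
  define B where "B = (\<lambda>T. integral {t0..T} (\<lambda>\<tau>. 1 / l \<tau>))"
  have B: "(B has_real_derivative 1 / l t) (at t within {t0..})" if "t \<ge> t0" for t
    unfolding B_def using that l_nonzero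
    by (intro integral_has_real_derivative_atLeast continuous_intros l_cont) auto
  have y_le: "y t \<le> - k" if "t \<ge> t1" for t
    unfolding k_def minus_minus
  proof (rule deriv_nonpos_imp_antimono[of t1 t "{t0..}" y])
    fix r assume r: "r \<in> {t1..t}"
    then have r0: "r \<in> {t0..}" "r \<ge> t0" "r \<ge> t1" using t1 by auto
    show "(y has_real_derivative - (vdp_damping \<mu> r (x r) * (y r / l r)) - \<nu> r * x r) (at r within {t0..})"
      by (rule solves_systemD(2)[OF sys r0(1)])
    have "vdp_damping \<mu> r (x r) \<le> 0"
      unfolding vdp_damping_def using x[OF r0(3)] mu_nonneg[OF r0(2)]
      by (intro mult_nonneg_nonpos) (auto intro: power_le_one)
    moreover have "y r / l r \<le> 0" using y[OF r0(3)] l_pos[OF r0(2)] by (simp add: divide_le_0_iff)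
    ultimately have "0 \<le> vdp_damping \<mu> r (x r) * (y r / l r)" by (rule mult_nonpos_nonpos)
    moreover have "0 \<le> \<nu> r * x r" using x[OF r0(3)] nu_nonneg[OF r0(2)] by simp
    ultimately show "- (vdp_damping \<mu> r (x r) * (y r / l r)) - \<nu> r * x r \<le> 0" by simp
  qed (use that t1 in auto)
  show False
  proof (rule filterlim_at_top_not_bounded[OF div])
    show "k > 0" using y[of t1] by (simp add: k_def)
    fix t assume t: "t \<ge> t1"
    have "x t + k * B t \<le> x t1 + k * B t1"
    proof (rule deriv_nonpos_imp_antimono[of t1 t "{t0..}" "\<lambda>t. x t + k * B t"])
      fix r assume r: "r \<in> {t1..t}"
      then have r0: "r \<in> {t0..}" "r \<ge> t0" "r \<ge> t1" using t1 by auto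
      show "((\<lambda>t. x t + k * B t) has_real_derivative (y r + k) / l r) (at r within {t0..})"
        using solves_systemD(1)[OF sys r0(1)] B[OF r0(2)]
        by (auto intro!: derivative_eq_intros simp: add_divide_distrib)
      show "(y r + k) / l r \<le> 0" using y_le[OF r0(3)] l_pos[OF r0(2)] by (simp add: divide_le_0_iff)
    qed (use t t1 in auto)
    then show "k * integral {t0..t} (\<lambda>\<tau>. 1 / l \<tau>) \<le> x t1 + k * B t1"
      using x(1)[OF t] by (simp add: B_def)
  qed
qed

text \<open>As \<open>y < 0\<close> and \<open>x \<le> \<epsilon>\<close>, replacing
  \<open>x\<close> by \<open>\<epsilon>\<close> in the damping only raises the derivative of
  \<open>y\<close>. Variation of constants gives \<open>y \<le> - k * G\<close>, and the second
  divergent integral then drives \<open>x\<close> below every bound.\<close>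

lemma fast_decreasing_contradiction:
  assumes sys: "solves_system {t0..} l (vdp_damping \<mu>) \<nu> x y"
    and t1: "t1 \<ge> t0" and x: "\<And>t. t \<ge> t1 \<Longrightarrow> 1 \<le> x t" "\<And>t. t \<ge> t1 \<Longrightarrow> x t \<le> \<epsilon>"
    and y: "\<And>t. t \<ge> t1 \<Longrightarrow> y t < 0"
    and div: "filterlim
        (\<lambda>T. integral {t0..T} (\<lambda>\<tau>. 1 / l \<tau> *
           integral {t0..\<tau>} (\<lambda>s. exp (- integral {s..\<tau>} (\<lambda>\<xi>. \<mu> \<xi> * (\<epsilon>\<^sup>2 - 1) / l \<xi>)) * \<nu> s)))
        at_top at_top"
  shows False
proof -
  define g where "g = (\<lambda>\<xi>. \<mu> \<xi> * (\<epsilon>\<^sup>2 - 1) / l \<xi>)"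
  have g: "continuous_on {t0..} g"
    unfolding g_def using l_nonzero by (intro continuous_intros l_cont mu_cont) auto
  define A where "A = (\<lambda>t. integral {t0..t} g)"
  have A: "(A has_real_derivative g t) (at t within {t0..})" if "t \<ge> t0" for t
    unfolding A_def by (rule integral_has_real_derivative_atLeast[OF g that])
  have A_cont: "continuous_on {t0..} A" using A by (intro DERIV_continuous_on) simp
  define H where "H = (\<lambda>t. integral {t0..t} (\<lambda>s. exp (A s) * \<nu> s))"
  have H: "(H has_real_derivative exp (A t) * \<nu> t) (at t within {t0..})" if "t \<ge> t0" for t
    unfolding H_def using that
    by (intro integral_has_real_derivative_atLeast continuous_intros A_cont nu_cont) auto
  have H_cont: "continuous_on {t0..} H" using H by (intro DERIV_continuous_on) simp
  have H_nonneg: "0 \<le> H t" for t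
    unfolding H_def
  proof (rule integral_nonneg)
    show "(\<lambda>s. exp (A s) * \<nu> s) integrable_on {t0..t}"
      by (intro integrable_continuous_interval continuous_intros continuous_on_subset[OF A_cont]
          continuous_on_subset[OF nu_cont]) auto
  qed (use nu_nonneg in auto)
  define G where "G = (\<lambda>t. exp (- A t) * H t)"
  \<comment> \<open>The kernel splits into \<open>exp (- A \<tau>)\<close> and
    \<open>exp (A s)\<close>, so the inner integral of the divergence condition becomes a
    differentiable product.\<close>
  have G: "integral {t0..\<tau>} (\<lambda>s. exp (- integral {s..\<tau>} g) * \<nu> s) = G \<tau>" for \<tau>
  proof -
    have "integral {t0..\<tau>} (\<lambda>s. exp (- integral {s..\<tau>} g) * \<nu> s)
        = integral {t0..\<tau>} (\<lambda>s. exp (- A \<tau>) * (exp (A s) * \<nu> s))"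
    proof (rule integral_cong)
      fix s assume s: "s \<in> {t0..\<tau>}"
      have "A s + integral {s..\<tau>} g = A \<tau>"
        unfolding A_def using s
        by (intro Henstock_Kurzweil_Integration.integral_combine integrable_continuous_interval
            continuous_on_subset[OF g]) auto
      then have "- integral {s..\<tau>} g = - A \<tau> + A s" by simp
      then show "exp (- integral {s..\<tau>} g) * \<nu> s = exp (- A \<tau>) * (exp (A s) * \<nu> s)"
        by (simp only: exp_add mult.assoc)
    qed
    then show ?thesis by (simp add: G_def H_def)
  qed
  define B where "B = (\<lambda>T. integral {t0..T} (\<lambda>\<tau>. 1 / l \<tau> * G \<tau>))"
  have B: "(B has_real_derivative 1 / l t * G t) (at t within {t0..})" if "t \<ge> t0" for t
    unfolding B_def G_def using that l_nonzero
    by (intro integral_has_real_derivative_atLeast continuous_intros l_cont A_cont H_cont) auto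
  have B_lim: "filterlim B at_top at_top"
    using div unfolding g_def[symmetric] G B_def .
  \<comment> \<open>The bound 1 ensures \<open>k \<le> x\<close>, so the force dominates
    \<open>\<nu> * k\<close>; the other entry makes the comparison hold at \<open>t1\<close>. Adding
    1 avoids a division by zero when \<open>H t1 = 0\<close>.\<close>
  define k where "k = min 1 (- y t1 * exp (A t1) / (H t1 + 1))"
  have k: "0 < k" "k \<le> 1"
    using y[of t1] H_nonneg[of t1] by (auto simp: k_def intro!: divide_neg_pos mult_neg_pos)
  have "k \<le> - y t1 * exp (A t1) / (H t1 + 1)" by (simp add: k_def)
  then have "k * (H t1 + 1) \<le> - y t1 * exp (A t1)"
    using H_nonneg[of t1] by (subst (asm) pos_le_divide_eq) auto
  then have init: "y t1 * exp (A t1) + k * H t1 \<le> 0"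
    using H_nonneg[of t1] k(1) by (simp add: algebra_simps)
  \<comment> \<open>\<open>- k G\<close> solves the linear equation for \<open>y\<close> with \<open>\<phi>\<close> frozen at \<open>\<epsilon>\<close> in the damping and at \<open>k\<close>
    in the restoring force.\<close>
  have y_le: "y t + k * G t \<le> 0" if t: "t \<ge> t1" for t
  proof -
    have "y t * exp (A t) + k * H t \<le> y t1 * exp (A t1) + k * H t1"
    proof (rule deriv_nonpos_imp_antimono[of t1 t "{t0..}" "\<lambda>t. y t * exp (A t) + k * H t"])
      fix r assume r: "r \<in> {t1..t}"
      then have r0: "r \<in> {t0..}" "r \<ge> t0" "r \<ge> t1" using t1 by auto
      have l: "l r \<noteq> 0" using l_nonzero[OF r0(2)] .
      show "((\<lambda>t. y t * exp (A t) + k * H t) has_real_derivative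
          exp (A r) * (\<mu> r / l r * (\<epsilon>\<^sup>2 - (x r)\<^sup>2) * y r - \<nu> r * (x r - k))) (at r within {t0..})"
        using solves_systemD(2)[OF sys r0(1)] A[OF r0(2)] H[OF r0(2)] l
        by (auto intro!: derivative_eq_intros simp: g_def vdp_damping_def field_simps)
      have "(x r)\<^sup>2 \<le> \<epsilon>\<^sup>2" using x[OF r0(3)] by (intro power_mono) auto
      then have "\<mu> r / l r * (\<epsilon>\<^sup>2 - (x r)\<^sup>2) * y r \<le> 0"
        using y[OF r0(3)] mu_nonneg[OF r0(2)] l_pos[OF r0(2)]
        by (intro mult_nonneg_nonpos) auto
      moreover have "0 \<le> \<nu> r * (x r - k)"
        using x(1)[OF r0(3)] k nu_nonneg[OF r0(2)] by (intro mult_nonneg_nonneg) auto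
      ultimately show "exp (A r) * (\<mu> r / l r * (\<epsilon>\<^sup>2 - (x r)\<^sup>2) * y r - \<nu> r * (x r - k)) \<le> 0"
        by (intro mult_nonneg_nonpos) auto
    qed (use t t1 in auto)
    then have "y t * exp (A t) + k * H t \<le> 0" using init by linarith
    then have "exp (- A t) * (y t * exp (A t) + k * H t) \<le> 0" by (intro mult_nonneg_nonpos) auto
    then show ?thesis by (simp add: G_def exp_minus field_simps)
  qed
  show False
  proof (rule filterlim_at_top_not_bounded[OF B_lim k(1)])
    fix t assume t: "t \<ge> t1"
    have "x t + k * B t \<le> x t1 + k * B t1"
    proof (rule deriv_nonpos_imp_antimono[of t1 t "{t0..}" "\<lambda>t. x t + k * B t"])
      fix r assume r: "r \<in> {t1..t}"
      then have r0: "r \<in> {t0..}" "r \<ge> t0" "r \<ge> t1" using t1 by auto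
      show "((\<lambda>t. x t + k * B t) has_real_derivative (y r + k * G r) / l r) (at r within {t0..})"
        using solves_systemD(1)[OF sys r0(1)] B[OF r0(2)]
        by (auto intro!: derivative_eq_intros simp: add_divide_distrib)
      show "(y r + k * G r) / l r \<le> 0" using y_le[OF r0(3)] l_pos[OF r0(2)] by (simp add: divide_le_0_iff)
    qed (use t t1 in auto)
    then show "k * B t \<le> x t1 + k * B t1" using x(1)[OF t] by simp
  qed
qed

section \<open>Sign changes of nontrivial solutions\<close>

lemma not_eventually_nonneg:
  assumes sys: "solves_system {t0..} l (vdp_damping \<mu>) \<nu> x y" and nz: "(x t0, y t0) \<noteq> (0, 0)"
    and div: "filterlim (\<lambda>T. integral {t0..T} (\<lambda>\<tau>. 1 / l \<tau>)) at_top at_top"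
    and div': "\<And>\<epsilon>. \<epsilon> \<ge> 1 \<Longrightarrow> filterlim
        (\<lambda>T. integral {t0..T} (\<lambda>\<tau>. 1 / l \<tau> *
           integral {t0..\<tau>} (\<lambda>s. exp (- integral {s..\<tau>} (\<lambda>\<xi>. \<mu> \<xi> * (\<epsilon>\<^sup>2 - 1) / l \<xi>)) * \<nu> s)))
        at_top at_top"
    and osc: "\<epsilon>0 > 0" "\<And>\<epsilon>. 0 < \<epsilon> \<Longrightarrow> \<epsilon> \<le> \<epsilon>0 \<Longrightarrow>
        oscillatory_linear_equation t0 l (\<lambda>t. \<mu> t * (\<epsilon>\<^sup>2 - 1)) \<nu>"
    and T: "T \<ge> t0"
  shows "\<exists>t\<ge>T. x t < 0"
proof (rule ccontr)
  assume "\<not> (\<exists>t\<ge>T. x t < 0)"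
  then have x_nonneg: "\<And>t. t \<ge> T \<Longrightarrow> 0 \<le> x t" by force
  show False
  proof (cases "\<exists>t1\<ge>T. y t1 < 0")
    case True
    then obtain t1 where t1: "t1 \<ge> T" "y t1 < 0" by blast
    have t10: "t1 \<ge> t0" using t1 T by simp
    have xn: "0 \<le> x t" if "t \<ge> t1" for t using x_nonneg t1 that by simp
    have y_neg: "y t < 0" if "t \<ge> t1" for t
      by (rule velocity_stays_negative[OF sys t10 xn t1(2) that])
    have x_anti: "x t \<le> x s" if st: "t1 \<le> s" "s \<le> t" for s t
    proof (rule deriv_nonpos_imp_antimono[of s t "{t0..}" x])
      fix r assume "r \<in> {s..t}"
      then have r: "r \<in> {t0..}" "r \<ge> t0" "r \<ge> t1" using st t10 by auto
      show "(x has_real_derivative y r / l r) (at r within {t0..})" by (rule solves_systemD(1)[OF sys r(1)])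
      show "y r / l r \<le> 0" using y_neg[OF r(3)] l_pos[OF r(2)] by (simp add: divide_le_0_iff)
    qed (use st t10 in auto)
    show False
    \<comment> \<open>Because \<open>x\<close> is nonincreasing, it either falls below 1 for good or
      stays at least 1; in the second case \<open>x t1 \<ge> 1\<close> serves as the upper bound
      \<open>\<epsilon>\<close>.\<close>
    proof (cases "\<exists>t2\<ge>t1. x t2 < 1")
      case True
      then obtain t2 where t2: "t2 \<ge> t1" "x t2 < 1" by blast
      show False
      proof (rule slow_decreasing_contradiction[OF sys _ _ _ _ div])
        show "t2 \<ge> t0" using t2 t10 by simp
        fix t assume t: "t \<ge> t2"
        show "0 \<le> x t" "y t < 0" using xn y_neg t t2 by auto
        show "x t \<le> 1" using x_anti[OF t2(1) t] t2(2) by simp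
      qed
    next
      case False
      then have x_ge: "1 \<le> x t" if "t \<ge> t1" for t using that by force
      show False
        by (rule fast_decreasing_contradiction[OF sys t10 x_ge x_anti[OF order_refl] y_neg div'[OF x_ge[OF order_refl]]])
    qed
  next
    case False
    then have y_nonneg: "\<And>t. t \<ge> T \<Longrightarrow> 0 \<le> y t" by force
    \<comment> \<open>Monotonicity alone does not exclude \<open>x = 0\<close> from \<open>T\<close>
      on. In that case \<open>y T = 0\<close> too, and a nontrivial trajectory would pass through
      the origin.\<close>
    have "\<exists>T'\<ge>T. x T' \<noteq> 0"
    proof (rule ccontr)
      assume "\<not> (\<exists>T'\<ge>T. x T' \<noteq> 0)"
      then have x0: "x t = 0" if "t \<ge> T" for t using that by blast
      have "(x has_real_derivative y T / l T) (at T within {T..T+1})"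
        by (rule has_field_derivative_subset[OF solves_systemD(1)[OF sys]]) (use T in auto)
      moreover have "(x has_real_derivative 0) (at T within {T..T+1})"
        using DERIV_const[of 0 "at T within {T..T+1}"] unfolding has_field_derivative_def
        by (rule has_derivative_transform[rotated 2]) (use x0 in auto)
      moreover have "at T within {T..T+1} \<noteq> bot" by (simp add: trivial_limit_within islimpt_Icc)
      ultimately have "y T / l T = 0"
        unfolding has_real_derivative_iff_has_vector_derivative
        by (intro vector_derivative_unique_within)
      then have "(x T, y T) = (0, 0)" using l_nonzero[OF T] x0[of T] by simp
      then show False using vdp_system_nonzero[OF sys nz T] by simp
    qed
    then obtain T' where T': "T' \<ge> T" "x T' \<noteq> 0" by blast
    have T'0: "T' \<ge> t0" "0 < x T'" using T' T x_nonneg[of T'] by auto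
    have x_mono: "x T' \<le> x t" if t: "t \<ge> T'" for t
    proof -
      have "- x t \<le> - x T'"
      proof (rule deriv_nonpos_imp_antimono[of T' t "{t0..}" "\<lambda>t. - x t"])
        fix r assume "r \<in> {T'..t}"
        then have r: "r \<in> {t0..}" "r \<ge> t0" "r \<ge> T" using T'0 T' by auto
        show "((\<lambda>t. - x t) has_real_derivative - (y r / l r)) (at r within {t0..})"
          using solves_systemD(1)[OF sys r(1)] by (rule DERIV_minus)
        show "- (y r / l r) \<le> 0" using y_nonneg[OF r(3)] l_pos[OF r(2)] by simp
      qed (use t T'0 in auto)
      then show ?thesis by simp
    qed
    \<comment> \<open>The minimum lies in the range of condition (b) and still bounds
      \<open>x\<close> from below after \<open>T'\<close>.\<close>
    define \<epsilon> where "\<epsilon> = min \<epsilon>0 (x T')"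
    have "\<not> oscillatory_linear_equation t0 l (\<lambda>t. \<mu> t * (\<epsilon>\<^sup>2 - 1)) \<nu>"
    proof (rule oscillatory_linear_comparison[OF sys T'0(1)])
      show "\<epsilon> > 0" using osc(1) T'0 by (simp add: \<epsilon>_def)
      fix t assume "t \<ge> T'"
      then show "\<epsilon> \<le> x t" "0 \<le> y t" using x_mono[of t] y_nonneg[of t] T' by (auto simp: \<epsilon>_def)
    qed
    moreover have "0 < \<epsilon>" "\<epsilon> \<le> \<epsilon>0" using osc(1) T'0 by (auto simp: \<epsilon>_def)
    ultimately show False using osc(2) by blast
  qed
qed

text \<open>The damping depends on \<open>x\<close> through its square only. Reflection thus turns
  the existence of negative values into that of positive ones.\<close>

lemma vdp_system_minus:
  assumes sys: "solves_system {t0..} l (vdp_damping \<mu>) \<nu> x y"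
  shows "solves_system {t0..} l (vdp_damping \<mu>) \<nu> (\<lambda>t. - x t) (\<lambda>t. - y t)"
  unfolding solves_system_def
proof (intro ballI conjI)
  fix t assume t: "t \<in> {t0..}"
  show "((\<lambda>t. - x t) has_real_derivative - y t / l t) (at t within {t0..})"
    using DERIV_minus[OF solves_systemD(1)[OF sys t]] by simp
  show "((\<lambda>t. - y t) has_real_derivative
      - (vdp_damping \<mu> t (- x t) * (- y t / l t)) - \<nu> t * - x t) (at t within {t0..})"
    using DERIV_minus[OF solves_systemD(2)[OF sys t]] by (simp add: vdp_damping_def add.commute)
qed

lemma vdp_is_solution_on:
  assumes sys: "solves_system {t0..} l (vdp_damping \<mu>) \<nu> x y"
  shows "is_solution_on {t0..} l (vdp_damping \<mu>) \<nu> x"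
proof (rule solves_system_imp_is_solution_on[OF sys])
  show "continuous_on {t0..} (\<lambda>t. vdp_damping \<mu> t (x t))"
    unfolding vdp_damping_def
    by (intro continuous_intros mu_cont solves_system_continuous_on(1)[OF sys])
qed (use l_nonzero l_cont nu_cont in auto)

lemma vdp_oscillatory:
  assumes sys: "solves_system {t0..} l (vdp_damping \<mu>) \<nu> x y" and nz: "(x t0, y t0) \<noteq> (0, 0)"
    and div: "filterlim (\<lambda>T. integral {t0..T} (\<lambda>\<tau>. 1 / l \<tau>)) at_top at_top"
    and div': "\<And>\<epsilon>. \<epsilon> \<ge> 1 \<Longrightarrow> filterlim
        (\<lambda>T. integral {t0..T} (\<lambda>\<tau>. 1 / l \<tau> *
           integral {t0..\<tau>} (\<lambda>s. exp (- integral {s..\<tau>} (\<lambda>\<xi>. \<mu> \<xi> * (\<epsilon>\<^sup>2 - 1) / l \<xi>)) * \<nu> s)))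
        at_top at_top"
    and osc: "\<epsilon>0 > 0" "\<And>\<epsilon>. 0 < \<epsilon> \<Longrightarrow> \<epsilon> \<le> \<epsilon>0 \<Longrightarrow>
        oscillatory_linear_equation t0 l (\<lambda>t. \<mu> t * (\<epsilon>\<^sup>2 - 1)) \<nu>"
  shows "oscillatory_solution t0 l (vdp_damping \<mu>) \<nu> x"
  unfolding oscillatory_solution_def
proof (intro conjI allI impI)
  show "is_solution_on {t0..} l (vdp_damping \<mu>) \<nu> x" by (rule vdp_is_solution_on[OF sys])
  fix T assume T: "T \<ge> t0"
  have "\<exists>t\<ge>T. x t < 0" by (rule not_eventually_nonneg[OF sys nz div div' osc T])
  moreover have "\<exists>t\<ge>T. - x t < 0"
    by (rule not_eventually_nonneg[OF vdp_system_minus[OF sys] _ div div' osc T]) (use nz in auto)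
  ultimately show "\<exists>s\<ge>T. \<exists>t\<ge>T. x s < 0 \<and> 0 < x t" by auto
qed

section \<open>The initial value problem and the final statement\<close>

text \<open>The prescribed slope fixes the second component because one-sided derivatives at
  \<open>t0\<close> are unique; \<open>T > t0\<close> makes the filter there nontrivial.\<close>

lemma vdp_ivp_system:
  assumes ivp: "solves_ivp_on {t0..<T} l (vdp_damping \<mu>) \<nu> t0 a b \<psi>" and T: "T > t0"
  shows "\<exists>z. solves_system {t0..<T} l (vdp_damping \<mu>) \<nu> \<psi> z \<and> \<psi> t0 = a \<and> z t0 = l t0 * b"
proof -
  have sol: "is_solution_on {t0..<T} l (vdp_damping \<mu>) \<nu> \<psi>" and a: "\<psi> t0 = a"
    and b: "(\<psi> has_real_derivative b) (at t0 within {t0..<T})"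
    using ivp by (auto simp: solves_ivp_on_def)
  obtain z where z: "solves_system {t0..<T} l (vdp_damping \<mu>) \<nu> \<psi> z"
    using is_solution_on_imp_solves_system[OF sol l_nonzero] by (meson atLeastLessThan_iff)
  have "(\<psi> has_real_derivative z t0 / l t0) (at t0 within {t0..<T})"
    using T by (intro solves_systemD(1)[OF z]) auto
  moreover have "at t0 within {t0..<T} \<noteq> bot"
    using T by (simp add: trivial_limit_within islimpt_Ico)
  ultimately have "z t0 / l t0 = b"
    using b unfolding has_real_derivative_iff_has_vector_derivative
    by (intro vector_derivative_unique_within)
  then have "z t0 = l t0 * b" using l_nonzero[of t0] by (simp add: field_simps)
  then show ?thesis using z a by blast
qed

end

text \<open>Uniqueness on every bounded \<open>{t0..<T}\<close> covers local solutions as well: each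
  is a restriction of \<open>\<phi>\<close>, which justifies speaking of the solution. Zero data are
  excluded from the oscillation claim since their solution vanishes identically.\<close>

theorem theorem4p2:
  fixes t0 :: real and l \<mu> \<nu> :: "real \<Rightarrow> real" and a b :: real
  assumes l_cont: "continuous_on {t0..} l" and l_pos: "\<And>t. t \<ge> t0 \<Longrightarrow> l t > 0"
    and mu_cont: "continuous_on {t0..} \<mu>" and mu_nonneg: "\<And>t. t \<ge> t0 \<Longrightarrow> \<mu> t \<ge> 0"
    and nu_cont: "continuous_on {t0..} \<nu>" and nu_nonneg: "\<And>t. t \<ge> t0 \<Longrightarrow> \<nu> t \<ge> 0"
  shows "\<exists>\<phi>.
    solves_ivp_on {t0..} l (vdp_damping \<mu>) \<nu> t0 a b \<phi> \<and>
    (\<forall>T>t0. \<forall>\<psi>. solves_ivp_on {t0..<T} l (vdp_damping \<mu>) \<nu> t0 a b \<psi> \<longrightarrow>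
        (\<forall>t\<in>{t0..<T}. \<psi> t = \<phi> t)) \<and>
    ((a, b) \<noteq> (0, 0) \<and>
     filterlim (\<lambda>T. integral {t0..T} (\<lambda>\<tau>. 1 / l \<tau>)) at_top at_top \<and>
     (\<forall>\<epsilon>\<ge>1. filterlim
        (\<lambda>T. integral {t0..T} (\<lambda>\<tau>. 1 / l \<tau> *
           integral {t0..\<tau>} (\<lambda>s. exp (- integral {s..\<tau>} (\<lambda>\<xi>. \<mu> \<xi> * (\<epsilon>\<^sup>2 - 1) / l \<xi>)) * \<nu> s)))
        at_top at_top) \<and>
     (\<exists>\<epsilon>0>0. \<forall>\<epsilon>. 0 < \<epsilon> \<and> \<epsilon> \<le> \<epsilon>0 \<longrightarrow>
        oscillatory_linear_equation t0 l (\<lambda>t. \<mu> t * (\<epsilon>\<^sup>2 - 1)) \<nu>)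
     \<longrightarrow> oscillatory_solution t0 l (vdp_damping \<mu>) \<nu> \<phi>)"
proof -
  interpret vdp_coefficients t0 l \<mu> \<nu>
    using assms by unfold_locales
  obtain x y where sys: "solves_system {t0..} l (vdp_damping \<mu>) \<nu> x y"
    and x0: "x t0 = a" and y0: "y t0 = l t0 * b"
    using vdp_system_exists by blast
  have dx: "(x has_real_derivative b) (at t0 within {t0..})"
    using solves_systemD(1)[OF sys, of t0] l_nonzero[of t0] by (simp add: y0)
  have "\<psi> t = x t" if T: "T > t0" and \<psi>: "solves_ivp_on {t0..<T} l (vdp_damping \<mu>) \<nu> t0 a b \<psi>"
    and t: "t \<in> {t0..<T}" for T \<psi> t
  proof -
    obtain z where z: "solves_system {t0..<T} l (vdp_damping \<mu>) \<nu> \<psi> z" "\<psi> t0 = a" "z t0 = l t0 * b"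
      using vdp_ivp_system[OF \<psi> T] by blast
    have sys': "solves_system {t0..<T} l (vdp_damping \<mu>) \<nu> x y"
      by (rule solves_system_subset[OF sys]) auto
    show ?thesis
      by (rule vdp_system_unique[OF _ _ _ z(1) sys' _ _ t]) (use T z(2,3) x0 y0 in \<open>auto simp: is_interval_1\<close>)
  qed
  then have uniq: "\<forall>T>t0. \<forall>\<psi>. solves_ivp_on {t0..<T} l (vdp_damping \<mu>) \<nu> t0 a b \<psi> \<longrightarrow> (\<forall>t\<in>{t0..<T}. \<psi> t = x t)"
    by blast
  have nz: "(x t0, y t0) \<noteq> (0, 0)" if "(a, b) \<noteq> (0, 0)"
    using that l_nonzero[of t0] by (auto simp: x0 y0)
  have ivp: "solves_ivp_on {t0..} l (vdp_damping \<mu>) \<nu> t0 a b x"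
    unfolding solves_ivp_on_def using vdp_is_solution_on[OF sys] x0 dx by blast
  show ?thesis
  proof (rule exI[of _ x], rule conjI[OF ivp], rule conjI[OF uniq], rule impI, elim conjE exE)
    fix \<epsilon>0 :: real
    assume ab: "(a, b) \<noteq> (0, 0)" and div: "filterlim (\<lambda>T. integral {t0..T} (\<lambda>\<tau>. 1 / l \<tau>)) at_top at_top"
      and div': "\<forall>\<epsilon>\<ge>1. filterlim
        (\<lambda>T. integral {t0..T} (\<lambda>\<tau>. 1 / l \<tau> *
           integral {t0..\<tau>} (\<lambda>s. exp (- integral {s..\<tau>} (\<lambda>\<xi>. \<mu> \<xi> * (\<epsilon>\<^sup>2 - 1) / l \<xi>)) * \<nu> s)))
        at_top at_top"
      and osc: "\<epsilon>0 > 0" "\<forall>\<epsilon>. 0 < \<epsilon> \<and> \<epsilon> \<le> \<epsilon>0 \<longrightarrow>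
        oscillatory_linear_equation t0 l (\<lambda>t. \<mu> t * (\<epsilon>\<^sup>2 - 1)) \<nu>"
    show "oscillatory_solution t0 l (vdp_damping \<mu>) \<nu> x"
    proof (rule vdp_oscillatory[OF sys nz[OF ab] div _ osc(1)])
      fix \<epsilon> :: real
      show "filterlim
        (\<lambda>T. integral {t0..T} (\<lambda>\<tau>. 1 / l \<tau> *
           integral {t0..\<tau>} (\<lambda>s. exp (- integral {s..\<tau>} (\<lambda>\<xi>. \<mu> \<xi> * (\<epsilon>\<^sup>2 - 1) / l \<xi>)) * \<nu> s)))
        at_top at_top" if "\<epsilon> \<ge> 1"
        using div' that by blast
      show "oscillatory_linear_equation t0 l (\<lambda>t. \<mu> t * (\<epsilon>\<^sup>2 - 1)) \<nu>" if "0 < \<epsilon>" "\<epsilon> \<le> \<epsilon>0"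
        using osc(2) that by blast
    qed
  qed
qed

end
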